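(* Let $G$ be a connected graph and let $W\subseteq V(G)$ be a set of pairwise true twins in $G$ with $|W|\geq 2$. Let $S=E(G[W])$ be the set of edges of $G$ with both endpoints in $W$, and $G-S$ the graph obtained from $G$ by deleting these edges. Then \[\operatorname{diam}(\mathcal{R}(G))-\binom{|W|}{2}\leq \operatorname{diam}(\mathcal{R}(G-S)).\]
   Context: Two vertices $u,v$ are true twins if $N[u]=N[v]$ (closed neighbourhoods). For a connected graph $G$, a search tree on $G$ is a rooted tree with vertex set $V(G)$ defined recursively: its root is some vertex $r\in V(G)$, and the children of $r$ are the roots of search trees on the connected components of $G-r$. For a rooted tree $T$ and $w\in V(T)$, $T|w$ denotes the subtree rooted at $w$. Let $T$ be a search tree on $G$, let $v$ be a child of $u$ in $T$, and let $p$ be the parent of $u$ (if it exists). The $uv$-rotation transforms $T$ into the search tree $T'$ in which: $u$ is a child of $v$ and $v$ is a child of $p$ (or $v$ is the root if $u$ was the root); every subtree of $u$ in $T$ other than $T|v$ is a subtree of $u$ in $T'$; and every subtree $S$ of $v$ in $T$ is a subtree of $u$ in $T'$ if $u$ is adjacent in $G$ to some vertex of $S$, and a subtree of $v$ in $T'$ otherwise. The rotation graph $\mathcal{R}(G)$ is the graph whose vertices are the search trees on $G$, two being adjacent iff they differ by one rotation. $\operatorname{diam}$ denotes graph diameter. *)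

theory Defs
  imports Main
begin

text \<open>A finite simple graph: vertex set V, symmetric irreflexive edge relation E
  whose edges lie inside V.\<close>
definition graph :: "'a set \<Rightarrow> ('a \<Rightarrow> 'a \<Rightarrow> bool) \<Rightarrow> bool" where
  "graph V E \<longleftrightarrow> finite V \<and> (\<forall>x y. E x y \<longrightarrow> E y x) \<and> (\<forall>x. \<not> E x x)
     \<and> (\<forall>x y. E x y \<longrightarrow> x \<in> V \<and> y \<in> V)"

text \<open>Edges of the induced subgraph G[X], as a relation.\<close>
definition ind_rel :: "('a \<Rightarrow> 'a \<Rightarrow> bool) \<Rightarrow> 'a set \<Rightarrow> ('a \<times> 'a) set" where
  "ind_rel E X = {(x, y). x \<in> X \<and> y \<in> X \<and> E x y}"

definition connected_on :: "('a \<Rightarrow> 'a \<Rightarrow> bool) \<Rightarrow> 'a set \<Rightarrow> bool" where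
  "connected_on E X \<longleftrightarrow> X \<noteq> {} \<and> (\<forall>u\<in>X. \<forall>v\<in>X. (u, v) \<in> (ind_rel E X)\<^sup>*)"

text \<open>The connected components of the induced subgraph G[X].\<close>
definition comps :: "('a \<Rightarrow> 'a \<Rightarrow> bool) \<Rightarrow> 'a set \<Rightarrow> 'a set set" where
  "comps E X = (\<lambda>v. {u. (v, u) \<in> (ind_rel E X)\<^sup>*}) ` X"

text \<open>Rooted forests are represented by parent maps: \<open>p x = Some y\<close> iff y is the
  parent of x; \<open>p x = None\<close> for roots and for vertices outside the forest.
  \<open>stree E X r p\<close>: p is a search tree on the (connected) induced graph G[X] with root r,
  defined recursively: the children of r are the roots of search trees on the
  components of G[X] - r.\<close>
inductive stree :: "('a \<Rightarrow> 'a \<Rightarrow> bool) \<Rightarrow> 'a set \<Rightarrow> 'a \<Rightarrow> ('a \<Rightarrow> 'a option) \<Rightarrow> bool"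
  for E where
  "\<lbrakk> finite X; connected_on E X; r \<in> X; p r = None;
     \<forall>v. v \<notin> X \<longrightarrow> p v = None;
     \<forall>v. v \<in> X - {r} \<longrightarrow> p v \<noteq> None;
     \<forall>C. C \<in> comps E (X - {r}) \<longrightarrow>
        (\<exists>c\<in>C. stree E C c (\<lambda>v. if v \<in> C \<and> p v \<noteq> Some r then p v else None)) \<rbrakk>
   \<Longrightarrow> stree E X r p"

text \<open>A search forest on G = (V,E) (a search tree on each connected component; for
  connected G this is exactly a search tree on G).\<close>
definition sforest :: "'a set \<Rightarrow> ('a \<Rightarrow> 'a \<Rightarrow> bool) \<Rightarrow> ('a \<Rightarrow> 'a option) \<Rightarrow> bool" where
  "sforest V E p \<longleftrightarrow> (\<forall>v. v \<notin> V \<longrightarrow> p v = None) \<and>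
     (\<forall>C \<in> comps E V. \<exists>r\<in>C. stree E C r (\<lambda>v. if v \<in> C then p v else None))"

definition par_rel :: "('a \<Rightarrow> 'a option) \<Rightarrow> ('a \<times> 'a) set" where
  "par_rel p = {(x, y). p x = Some y}"

text \<open>Vertex set of the subtree T|w.\<close>
definition desc :: "('a \<Rightarrow> 'a option) \<Rightarrow> 'a \<Rightarrow> 'a set" where
  "desc p w = {x. (x, w) \<in> (par_rel p)\<^sup>*}"

text \<open>The uv-rotation (v a child of u).\<close>
definition rotate :: "('a \<Rightarrow> 'a \<Rightarrow> bool) \<Rightarrow> ('a \<Rightarrow> 'a option) \<Rightarrow> 'a \<Rightarrow> 'a \<Rightarrow> ('a \<Rightarrow> 'a option)" where
  "rotate E p u v = (\<lambda>x. if x = v then p u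
      else if x = u then Some v
      else if p x = Some v \<and> (\<exists>y\<in>desc p x. E u y) then Some u
      else p x)"

definition is_rotation :: "('a \<Rightarrow> 'a \<Rightarrow> bool) \<Rightarrow> ('a \<Rightarrow> 'a option) \<Rightarrow> ('a \<Rightarrow> 'a option) \<Rightarrow> bool" where
  "is_rotation E p q \<longleftrightarrow> (\<exists>u v. p v = Some u \<and> q = rotate E p u v)"

text \<open>Edge relation of the rotation graph R(G).\<close>
definition rot_edge :: "'a set \<Rightarrow> ('a \<Rightarrow> 'a \<Rightarrow> bool) \<Rightarrow> (('a \<Rightarrow> 'a option) \<times> ('a \<Rightarrow> 'a option)) set" where
  "rot_edge V E = {(p, q). sforest V E p \<and> sforest V E q \<and>
      (is_rotation E p q \<or> is_rotation E q p)}"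

definition rot_dist :: "'a set \<Rightarrow> ('a \<Rightarrow> 'a \<Rightarrow> bool) \<Rightarrow> ('a \<Rightarrow> 'a option) \<Rightarrow> ('a \<Rightarrow> 'a option) \<Rightarrow> nat" where
  "rot_dist V E p q = (LEAST n. (p, q) \<in> (rot_edge V E) ^^ n)"

text \<open>Diameter of the rotation graph.\<close>
definition rot_diam :: "'a set \<Rightarrow> ('a \<Rightarrow> 'a \<Rightarrow> bool) \<Rightarrow> nat" where
  "rot_diam V E = Max {rot_dist V E p q | p q. sforest V E p \<and> sforest V E q}"

text \<open>Closed neighbourhood N[u].\<close>
definition cnbhd :: "'a set \<Rightarrow> ('a \<Rightarrow> 'a \<Rightarrow> bool) \<Rightarrow> 'a \<Rightarrow> 'a set" where
  "cnbhd V E u = {x \<in> V. E u x} \<union> {u}"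

text \<open>G - E(G[W]).\<close>
definition del_edges_in :: "('a \<Rightarrow> 'a \<Rightarrow> bool) \<Rightarrow> 'a set \<Rightarrow> 'a \<Rightarrow> 'a \<Rightarrow> bool" where
  "del_edges_in E W = (\<lambda>x y. E x y \<and> \<not> (x \<in> W \<and> y \<in> W))"

end

theory Submission
  imports Defs "HOL-Combinatorics.Transposition"
begin

text \<open>A search forest is determined by the vertex sets of its subtrees, and the \<open>uv\<close>-rotation only
  changes two of them: the set of \<open>v\<close> becomes that of \<open>u\<close>, and the set \<open>X\<close> of \<open>u\<close> becomes the
  component of \<open>u\<close> in \<open>X - v\<close>. Replacing the set of each \<open>x\<close> by the component of \<open>x\<close> in the
  subgraph $G-S$ therefore projects search forests on $G$ to search forests on $G-S$, and it maps
  rotations to rotations or identities. Since $W$ consists of true twins, two search trees on $G$ with the same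
  projection differ only in the order of the twins at the bottom, and every path of $n$ rotations
  on $G-S$ lifts to a path on $G$ with $n$ rotations and some additional swaps of a twin with its
  parent twin. A swap of \<open>a\<close> and \<open>b\<close> merely exchanges the two labels, which is
  an automorphism of $G$; so if the same pair is swapped twice, both swaps can be dropped after exchanging
  \<open>a\<close> and \<open>b\<close> in between. Hence each pair of twins is swapped at most once, which costs at most
  $\binom{|W|}{2}$ additional rotations.\<close>

subsection \<open>Components of induced subgraphs\<close>

text \<open>Everything rests on one property of true twins: a connected vertex set of $G$ not
  contained in $W$ stays connected in $G-S$, because an edge between two twins can be replaced by a
  detour through a neighbour outside $W$, which all twins share. The projection therefore alters
  only subtrees contained in $W$, and there every set becomes a singleton. This confines the
  ambiguity of lifting to swaps of twins: if \<open>v\<close> is a child of \<open>u\<close> in the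
  projection but not in the lift, then the subtree of the parent of \<open>v\<close> in the lift is
  contained in $W$, so \<open>v\<close> can be raised without changing the projection. Forests are
  needed because $G-S$ is disconnected when $W=V$. A bound on the swaps spent on each lifted
  rotation would depend on the length of the path; labels on the steps allow the pairs of twins to
  be charged once for the whole path, since cancelling two equal labels leaves the number of
  unlabelled steps unchanged.\<close>

definition component :: "('a \<Rightarrow> 'a \<Rightarrow> bool) \<Rightarrow> 'a set \<Rightarrow> 'a \<Rightarrow> 'a set" where
  "component E X x = {y. (x, y) \<in> (ind_rel E X)\<^sup>*}"

lemma comps_eq_components: "comps E X = component E X ` X"
  by (simp add: comps_def component_def)

lemma component_refl [simp]: "x \<in> component E X x"
  by (simp add: component_def)

text \<open>Induction along walks, stated for vertex sets: most upper bounds on components are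
  obtained by exhibiting a set closed under edges, so no walk is handled explicitly.\<close>

lemma component_closed:
  assumes "x \<in> Z" and "\<And>y z. y \<in> Z \<Longrightarrow> y \<in> X \<Longrightarrow> z \<in> X \<Longrightarrow> E y z \<Longrightarrow> z \<in> Z"
  shows "component E X x \<subseteq> Z"
proof
  fix y assume "y \<in> component E X x"
  then have "(x, y) \<in> (ind_rel E X)\<^sup>*" by (simp add: component_def)
  then show "y \<in> Z"
    by (induction rule: rtrancl_induct) (use assms in \<open>auto simp: ind_rel_def\<close>)
qed

lemma component_subset: "x \<in> X \<Longrightarrow> component E X x \<subseteq> X"
  by (rule component_closed) auto

lemma component_edge:
  "y \<in> component E X x \<Longrightarrow> y \<in> X \<Longrightarrow> z \<in> X \<Longrightarrow> E y z \<Longrightarrow> z \<in> component E X x"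
  by (auto simp: component_def ind_rel_def intro: rtrancl_into_rtrancl)

lemma component_mono:
  assumes "X \<subseteq> Y" and "\<And>x y. F x y \<Longrightarrow> E x y"
  shows "component F X x \<subseteq> component E Y x"
proof -
  have "ind_rel F X \<subseteq> ind_rel E Y" using assms by (auto simp: ind_rel_def)
  then show ?thesis unfolding component_def using rtrancl_mono by blast
qed

lemma component_sym:
  assumes "symp E" "y \<in> component E X x"
  shows "x \<in> component E X y"
proof -
  have "sym (ind_rel E X)" using assms(1) by (auto simp: ind_rel_def sym_def symp_def)
  then have "sym ((ind_rel E X)\<^sup>*)" by (rule sym_rtrancl)
  then show ?thesis using assms(2) by (auto simp: component_def sym_def)
qed

lemma component_trans:
  "y \<in> component E X x \<Longrightarrow> z \<in> component E X y \<Longrightarrow> z \<in> component E X x"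
  by (auto simp: component_def)

lemma component_eq:
  assumes "symp E" "y \<in> component E X x"
  shows "component E X y = component E X x"
  using assms component_sym[OF assms] by (auto intro: component_trans)

lemma connected_subset_component:
  assumes "connected_on E Y" "x \<in> Y" "Y \<subseteq> X"
  shows "Y \<subseteq> component E X x"
proof -
  have "Y \<subseteq> component E Y x" using assms by (auto simp: connected_on_def component_def)
  also have "\<dots> \<subseteq> component E X x" using assms(3) by (rule component_mono)
  finally show ?thesis .
qed

text \<open>A walk that starts at \<open>x\<close> inside \<open>X\<close> never leaves the
  component, hence stays in \<open>Z\<close>.\<close>

lemma component_restrict:
  assumes "component E X x \<subseteq> Z" "Z \<subseteq> X" "x \<in> X"
  shows "component E Z x = component E X x"
proof
  show "component E Z x \<subseteq> component E X x" using assms(2) by (rule component_mono)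
  have "component E X x \<subseteq> {y \<in> component E X x. y \<in> component E Z x}"
  proof (rule component_closed)
    fix y z assume *: "y \<in> {y \<in> component E X x. y \<in> component E Z x}" "y \<in> X" "z \<in> X" "E y z"
    then have "z \<in> component E X x" using component_edge by fastforce
    moreover have "z \<in> component E Z x"
      using * assms calculation component_edge[of y E Z x z] by blast
    ultimately show "z \<in> {y \<in> component E X x. y \<in> component E Z x}" by blast
  qed auto
  then show "component E X x \<subseteq> component E Z x" by blast
qed

lemma connected_on_component:
  assumes "symp E" "x \<in> X"
  shows "connected_on E (component E X x)"
proof -
  let ?K = "component E X x"
  have "v \<in> component E ?K u" if "u \<in> ?K" "v \<in> ?K" for u v
  proof -
    have "component E ?K x = ?K"
      using component_restrict[OF _ component_subset[OF assms(2)] assms(2)] by blast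
    then show ?thesis using that component_eq[OF assms(1)] by metis
  qed
  then show ?thesis by (auto simp: connected_on_def component_def)
qed

lemma connected_on_iff_component:
  assumes "symp E" "x \<in> X"
  shows "connected_on E X \<longleftrightarrow> component E X x = X"
  using assms connected_on_component[OF assms] connected_subset_component[of E X x X]
    component_subset[of x X E] by auto

text \<open>An \<open>F\<close>-walk from \<open>x\<close> in \<open>X\<close> is also an
  \<open>E\<close>-walk, so it already lies in the \<open>E\<close>-component. Rotations introduce
  \<open>E\<close>-components, and this removes them when projecting to \<open>F\<close>.\<close>

lemma component_component:
  assumes "\<And>x y. F x y \<Longrightarrow> E x y" "x \<in> X"
  shows "component F (component E X x) x = component F X x"
  by (rule component_restrict)
    (use assms component_mono[of X X F E] component_subset[of x X E] in auto)

subsection \<open>Tubings\<close>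

text \<open>The map sending each vertex to the vertex set of the subtree below it, described without recursion.\<close>
definition tubing :: "'a set \<Rightarrow> ('a \<Rightarrow> 'a \<Rightarrow> bool) \<Rightarrow> ('a \<Rightarrow> 'a set) \<Rightarrow> bool" where
  "tubing V E D \<longleftrightarrow>
     (\<forall>x\<in>V. x \<in> D x \<and> D x \<subseteq> V \<and> connected_on E (D x)) \<and>
     (\<forall>x\<in>V. \<forall>y\<in>D x. D y \<subseteq> D x \<and> (x \<in> D y \<longrightarrow> x = y)) \<and>
     (\<forall>x\<in>V. \<forall>y\<in>V. \<forall>z\<in>V. x \<in> D y \<and> x \<in> D z \<longrightarrow> y \<in> D z \<or> z \<in> D y) \<and>
     (\<forall>x\<in>V. \<forall>y\<in>V. E x y \<longrightarrow> x \<in> D y \<or> y \<in> D x)"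

text \<open>The covering relation of the tree order. Among the vertices strictly above
  \<open>x\<close>, \<open>y\<close> is required to be least and not merely minimal, so uniqueness
  follows from antisymmetry alone.\<close>

definition covered :: "'a set \<Rightarrow> ('a \<Rightarrow> 'a set) \<Rightarrow> 'a \<Rightarrow> 'a \<Rightarrow> bool" where
  "covered V D x y \<longleftrightarrow> x \<in> V \<and> y \<in> V \<and> x \<in> D y \<and> x \<noteq> y \<and> (\<forall>z\<in>V. x \<in> D z \<and> z \<noteq> x \<longrightarrow> y \<in> D z)"

text \<open>A relation and not a function, so that a given map can be recognised as the parent map
  of a tubing. Roots and vertices outside \<open>V\<close> are forced to \<open>None\<close>, since
  the equivalence ranges over all \<open>x\<close> and \<open>y\<close>.\<close>

definition parent_of :: "'a set \<Rightarrow> ('a \<Rightarrow> 'a set) \<Rightarrow> ('a \<Rightarrow> 'a option) \<Rightarrow> bool" where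
  "parent_of V D p \<longleftrightarrow> (\<forall>x y. p x = Some y \<longleftrightarrow> covered V D x y)"

lemma
  assumes "tubing V E D"
  shows tubing_refl: "x \<in> V \<Longrightarrow> x \<in> D x"
    and tubing_subset: "x \<in> V \<Longrightarrow> D x \<subseteq> V"
    and tubing_connected: "x \<in> V \<Longrightarrow> connected_on E (D x)"
    and tubing_trans: "x \<in> V \<Longrightarrow> y \<in> D x \<Longrightarrow> D y \<subseteq> D x"
    and tubing_antisym: "x \<in> V \<Longrightarrow> y \<in> D x \<Longrightarrow> x \<in> D y \<Longrightarrow> x = y"
    and tubing_edge: "x \<in> V \<Longrightarrow> y \<in> V \<Longrightarrow> E x y \<Longrightarrow> x \<in> D y \<or> y \<in> D x"
  using assms unfolding tubing_def by simp_all

lemma tubing_laminar: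
  assumes "tubing V E D" "y \<in> V" "z \<in> V" "x \<in> D y" "x \<in> D z"
  shows "y \<in> D z \<or> z \<in> D y"
proof -
  have "x \<in> V" using tubing_subset[OF assms(1,2)] assms(4) by blast
  then show ?thesis using assms unfolding tubing_def by simp
qed

lemma coveredD:
  assumes "covered V D x y"
  shows "x \<in> V" "y \<in> V" "x \<in> D y" "x \<noteq> y" "\<And>z. z \<in> V \<Longrightarrow> x \<in> D z \<Longrightarrow> z \<noteq> x \<Longrightarrow> y \<in> D z"
  using assms by (auto simp: covered_def)

lemma covered_unique:
  assumes "tubing V E D" "covered V D x y" "covered V D x z"
  shows "y = z"
  using tubing_antisym[OF assms(1), of y z] assms(2,3) unfolding covered_def by metis

lemma covered_not_mem:
  assumes "tubing V E D" "covered V D x y"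
  shows "y \<notin> D x"
proof
  note c = coveredD[OF assms(2)]
  assume "y \<in> D x"
  then show False using tubing_antisym[OF assms(1) c(1) _ c(3)] c(4) by simp
qed

text \<open>The forest obtained by deleting vertices in increasing order of the numbering
  \<open>f\<close>: the tube of \<open>x\<close> is its component when \<open>x\<close> is about to
  be deleted. It supplies the search forest that keeps the maximum in the diameter from ranging over
  an empty set.\<close>

lemma tubing_heap:
  assumes "symp E" "inj_on (f :: 'a \<Rightarrow> nat) V"
  shows "tubing V E (\<lambda>x. component E {z \<in> V. f x \<le> f z} x)"
proof -
  let ?S = "\<lambda>x. {z \<in> V. f x \<le> f z}"
  let ?D = "\<lambda>x. component E (?S x) x"
  have sub: "x \<in> V \<Longrightarrow> ?D x \<subseteq> ?S x" for x by (rule component_subset) auto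
  have mono: "f x \<le> f y \<Longrightarrow> component E (?S y) z \<subseteq> component E (?S x) z" for x y z
    by (rule component_mono) auto
  have tr: "?D y \<subseteq> ?D x" if "x \<in> V" "y \<in> ?D x" for x y
  proof -
    have "f x \<le> f y" using sub that by blast
    then have "?D y \<subseteq> component E (?S x) y" by (rule mono)
    also have "\<dots> = ?D x" using component_eq[OF assms(1) that(2)] .
    finally show ?thesis .
  qed
  have lam: "z \<in> ?D y" if "x \<in> ?D y" "x \<in> ?D z" "f y \<le> f z" for x y z
  proof -
    have "z \<in> component E (?S z) x" using that(2) component_sym[OF assms(1)] by blast
    then have "z \<in> component E (?S y) x" using mono[OF that(3)] by blast
    then show ?thesis using component_eq[OF assms(1) that(1)] by simp
  qed
  have edge: "y \<in> ?D x" if "x \<in> V" "y \<in> V" "E x y" "f x \<le> f y" for x y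
    using that component_edge[of x E "?S x" x y] by simp
  show ?thesis unfolding tubing_def
  proof (intro conjI ballI impI)
    fix x y assume xy: "x \<in> V" "y \<in> ?D x" "x \<in> ?D y"
    then have "y \<in> V" "f x \<le> f y" using sub by blast+
    moreover have "f y \<le> f x" using sub[OF \<open>y \<in> V\<close>] xy(3) by blast
    ultimately show "x = y" using xy(1) assms(2) by (simp add: inj_on_eq_iff)
  next
    fix x y z assume "x \<in> ?D y \<and> x \<in> ?D z"
    then show "y \<in> ?D z \<or> z \<in> ?D y" using lam linear[of "f y" "f z"] by meson
  next
    fix x y assume "x \<in> V" "y \<in> V" "E x y"
    then show "x \<in> ?D y \<or> y \<in> ?D x"
      using edge linear[of "f x" "f y"] sympD[OF assms(1)] by meson
  next
    fix x assume "x \<in> V"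
    then show "connected_on E (?D x)" by (intro connected_on_component assms(1)) simp
  qed (use sub tr in auto)
qed

text \<open>If \<open>y\<close> is in \<open>D z\<close>, then an \<open>F\<close>-walk inside
  \<open>D y\<close> is also one inside \<open>D z\<close>, so projected tubes that meet are nested
  in the same direction as the original ones. The edge condition is inherited because every edge of
  \<open>F\<close> is an edge of \<open>E\<close>.\<close>

lemma tubing_project:
  assumes "symp F" "\<And>x y. F x y \<Longrightarrow> E x y" "tubing V E D"
  shows "tubing V F (\<lambda>x. component F (D x) x)"
proof -
  note t = tubing_refl[OF assms(3)] tubing_subset[OF assms(3)] tubing_trans[OF assms(3)]
  let ?D = "\<lambda>x. component F (D x) x"
  have sub: "x \<in> V \<Longrightarrow> ?D x \<subseteq> D x" for x using t by (intro component_subset) 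
  have lam: "y \<in> ?D z" if "y \<in> V" "z \<in> V" "x \<in> ?D y" "x \<in> ?D z" "y \<in> D z" for x y z
  proof -
    have "y \<in> component F (D y) x" using that(3) component_sym[OF assms(1)] by blast
    then have "y \<in> component F (D z) x" using component_mono[of "D y" "D z" F F] t that by blast
    then show ?thesis using component_eq[OF assms(1) that(4)] by simp
  qed
  have edge: "x \<in> ?D y" if "x \<in> V" "y \<in> V" "F x y" "x \<in> D y" for x y
    using that t sympD[OF assms(1)] component_edge[of y F "D y" y x] by simp
  show ?thesis unfolding tubing_def
  proof (intro conjI ballI impI)
    fix x assume "x \<in> V"
    then show "connected_on F (?D x)" by (intro connected_on_component assms(1) t)
    show "?D x \<subseteq> V" using \<open>x \<in> V\<close> sub t by blast
  next
    fix x y assume xy: "x \<in> V" "y \<in> ?D x"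
    then have y: "y \<in> D x" using sub by blast
    have "?D y \<subseteq> component F (D x) y" using y t xy(1) by (intro component_mono) auto
    then show "?D y \<subseteq> ?D x" using component_eq[OF assms(1) xy(2)] by simp
    assume "x \<in> ?D y"
    then have "x \<in> D y" using sub[of y] y t xy by blast
    then show "x = y" using tubing_antisym[OF assms(3)] xy(1) y by blast
  next
    fix x y z assume *: "x \<in> V" "y \<in> V" "z \<in> V" "x \<in> ?D y \<and> x \<in> ?D z"
    then have "y \<in> D z \<or> z \<in> D y" using tubing_laminar[OF assms(3), of y z x] sub[of y] sub[of z] by blast
    then show "y \<in> ?D z \<or> z \<in> ?D y" using lam[of y z x] lam[of z y x] * by blast
  next
    fix x y assume *: "x \<in> V" "y \<in> V" "F x y"
    then show "x \<in> ?D y \<or> y \<in> ?D x"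
      using edge[of x y] edge[of y x] sympD[OF assms(1)] tubing_edge[OF assms(3)] assms(2) by blast
  qed auto
qed

text \<open>An edge leaving \<open>D x\<close> can only lead to some \<open>z\<close> other than
  \<open>x\<close> with \<open>x\<close> in \<open>D z\<close>. If \<open>z\<close> were in
  \<open>D' x\<close>, then \<open>x\<close> would be in \<open>D' z\<close> as well, against
  antisymmetry of \<open>D'\<close>. So \<open>D x\<close> is closed in the connected set
  \<open>D' x\<close> and fills it.\<close>

lemma tubing_eqI:
  assumes "symp E" "tubing V E D" "tubing V E D'" "\<And>x. x \<in> V \<Longrightarrow> D x \<subseteq> D' x" "x \<in> V"
  shows "D x = D' x"
proof
  show "D x \<subseteq> D' x" using assms by blast
  have "component E (D' x) x \<subseteq> D x"
  proof (rule component_closed)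
    show "x \<in> D x" using tubing_refl[OF assms(2,5)] .
    fix y z assume *: "y \<in> D x" "y \<in> D' x" "z \<in> D' x" "E y z"
    have V: "y \<in> V" "z \<in> V" using * tubing_subset[OF assms(3,5)] by auto
    from tubing_edge[OF assms(2) V *(4)] show "z \<in> D x"
    proof
      assume "y \<in> D z"
      then have "x \<in> D z \<or> z \<in> D x" using tubing_laminar[OF assms(2)] V * assms(5) by blast
      then show ?thesis
        using tubing_antisym[OF assms(3,5) *(3)] assms(4)[OF V(2)] tubing_refl[OF assms(2,5)] by blast
    qed (use tubing_trans[OF assms(2,5) *(1)] in blast)
  qed
  moreover have "component E (D' x) x = D' x"
    using connected_on_iff_component[OF assms(1)] tubing_connected[OF assms(3,5)]
      tubing_refl[OF assms(3,5)] by blast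
  ultimately show "D' x \<subseteq> D x" by simp
qed

text \<open>An edge leaving \<open>D v\<close> inside \<open>D u\<close> would lead to a
  \<open>z\<close> strictly above \<open>v\<close>, whose tube contains \<open>u\<close>; within
  \<open>D u\<close> this leaves only \<open>u\<close> itself. The fact links tubings to the
  recursion in \<open>stree\<close> and shows that a rotation can be undone.\<close>

lemma covered_component:
  assumes "symp E" "tubing V E D" "covered V D v u"
  shows "component E (D u - {u}) v = D v"
proof
  note c = coveredD[OF assms(3)]
  have vD: "D v \<subseteq> D u" using tubing_trans[OF assms(2) c(2,3)] .
  have u: "u \<notin> D v" using covered_not_mem[OF assms(2,3)] .
  show "D v \<subseteq> component E (D u - {u}) v"
    by (rule connected_subset_component[OF tubing_connected[OF assms(2) c(1)] tubing_refl[OF assms(2) c(1)]])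
      (use vD u in blast)
  show "component E (D u - {u}) v \<subseteq> D v"
  proof (rule component_closed)
    show "v \<in> D v" using tubing_refl[OF assms(2) c(1)] .
    fix y z assume *: "y \<in> D v" "y \<in> D u - {u}" "z \<in> D u - {u}" "E y z"
    have V: "y \<in> V" "z \<in> V" using * tubing_subset[OF assms(2) c(2)] by auto
    from tubing_edge[OF assms(2) V *(4)] show "z \<in> D v"
    proof
      assume "y \<in> D z"
      then have "v \<in> D z \<or> z \<in> D v" using tubing_laminar[OF assms(2) V(2) c(1) _ *(1)] by blast
      moreover have "z \<in> D v" if "v \<in> D z"
      proof (cases "z = v")
        case False
        then have "u \<in> D z" using c(5)[OF V(2) that] by simp
        then show ?thesis using tubing_antisym[OF assms(2) c(2), of z] *(3) by simp
      qed (use tubing_refl[OF assms(2) c(1)] in simp)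
      ultimately show ?thesis by blast
    qed (use tubing_trans[OF assms(2) c(1) *(1)] in blast)
  qed
qed

text \<open>Without such an edge \<open>D x\<close>, a component of \<open>D u - {u}\<close>, would
  also be a component of \<open>D u\<close>, which is connected and contains
  \<open>u\<close>.\<close>

lemma covered_edge:
  assumes "symp E" "tubing V E D" "covered V D x u"
  shows "\<exists>y\<in>D x. E u y"
proof (rule ccontr)
  assume no: "\<not> ?thesis"
  note c = coveredD[OF assms(3)]
  have xx: "x \<in> D x" using tubing_refl[OF assms(2) c(1)] .
  have eq: "component E (D u - {u}) x = D x" using covered_component[OF assms] .
  have "component E (D u) x \<subseteq> D x"
  proof (rule component_closed[OF xx])
    fix y z assume *: "y \<in> D x" "y \<in> D u" "z \<in> D u" "E y z"
    have "z \<noteq> u" using no *(1) sympD[OF assms(1) *(4)] by blast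
    moreover have "y \<noteq> u" using * covered_not_mem[OF assms(2,3)] by blast
    ultimately show "z \<in> D x"
      using component_edge[of y E "D u - {u}" x z] * eq by simp
  qed
  moreover have "component E (D u) x = D u"
    using connected_on_iff_component[OF assms(1) c(3)] tubing_connected[OF assms(2) c(2)] by blast
  ultimately have "u \<in> D x" using tubing_refl[OF assms(2) c(2)] by blast
  then show False using covered_not_mem[OF assms(2,3)] by blast
qed

subsection \<open>Rotations of tubings\<close>

definition rot_tubing :: "('a \<Rightarrow> 'a \<Rightarrow> bool) \<Rightarrow> ('a \<Rightarrow> 'a set) \<Rightarrow> 'a \<Rightarrow> 'a \<Rightarrow> 'a \<Rightarrow> 'a set" where
  "rot_tubing E D u v = D(v := D u, u := component E (D u - {v}) u)"

context
  fixes V :: "'a set" and E D u v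
  assumes E: "symp E" and D: "tubing V E D" and cov: "covered V D v u"
begin

lemma rot_tubing_props:
  shows "u \<in> V" "v \<in> V" "u \<noteq> v"
    "rot_tubing E D u v v = D u"
    "rot_tubing E D u v u = component E (D u - {v}) u"
    "x \<noteq> u \<Longrightarrow> x \<noteq> v \<Longrightarrow> rot_tubing E D u v x = D x"
    "component E (D u - {v}) u \<subseteq> D u - {v}"
proof -
  show "u \<in> V" "v \<in> V" "u \<noteq> v" using coveredD[OF cov] by auto
  then show "component E (D u - {v}) u \<subseteq> D u - {v}"
    using tubing_refl[OF D \<open>u \<in> V\<close>] by (intro component_subset) auto
qed (use coveredD[OF cov] in \<open>auto simp: rot_tubing_def\<close>)

lemma rot_tubing_below:
  assumes "z \<in> D u" "z \<noteq> u" "z \<noteq> v"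
  shows "v \<notin> D z"
proof
  assume "v \<in> D z"
  moreover have "z \<in> V" using tubing_subset[OF D coveredD(2)[OF cov]] assms by blast
  ultimately have "u \<in> D z" using coveredD[OF cov] assms by blast
  then show False using tubing_antisym[OF D coveredD(2)[OF cov] assms(1)] assms(2) by simp
qed

text \<open>Such a tube is connected and avoids \<open>v\<close>, so it lies wholly inside or wholly
  outside the new tube of \<open>u\<close>. This keeps the new family laminar and decides which
  subtrees end up below \<open>u\<close>.\<close>

lemma rot_tubing_part:
  assumes "z \<in> D u" "z \<noteq> u" "z \<noteq> v" "x \<in> D z" "x \<in> component E (D u - {v}) u"
  shows "D z \<subseteq> component E (D u - {v}) u"
proof -
  have z: "z \<in> V" using tubing_subset[OF D coveredD(2)[OF cov]] assms by blast
  have "D z \<subseteq> D u - {v}"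
    using tubing_trans[OF D _ assms(1)] rot_tubing_below[OF assms(1-3)] coveredD(2)[OF cov] by blast
  then have "D z \<subseteq> component E (D u - {v}) x"
    by (rule connected_subset_component[OF tubing_connected[OF D z] assms(4)])
  then show ?thesis using component_eq[OF E assms(5)] by simp
qed

text \<open>Tubes of vertices other than \<open>u\<close> and \<open>v\<close> are unchanged, so
  laminarity and the edge condition need a new argument only for pairs that involve \<open>u\<close>
  or \<open>v\<close>: these are \<open>lam_u\<close>, \<open>lam_v\<close>, \<open>edge_u\<close>,
  \<open>edge_v\<close>, and \<open>uv\<close> for the pair itself.\<close>

lemma tubing_rot: "tubing V E (rot_tubing E D u v)"
proof -
  let ?K = "component E (D u - {v}) u"
  let ?D = "rot_tubing E D u v"
  note P = rot_tubing_props
  note c = coveredD[OF cov]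
  note t = tubing_refl[OF D] tubing_subset[OF D] tubing_trans[OF D] tubing_antisym[OF D]
  have K: "v \<notin> ?K" "?K \<subseteq> D u" using P(7) by auto
  have lam_u: "z \<in> ?D u \<or> u \<in> ?D z" if "x \<in> ?D u" "x \<in> ?D z" "z \<in> V" "z \<noteq> u" "z \<noteq> v" for x z
  proof -
    have x: "x \<in> ?K" "x \<in> D z" using that P by auto
    then have "u \<in> D z \<or> z \<in> D u" using tubing_laminar[OF D c(2) that(3)] K by blast
    then show ?thesis
      using rot_tubing_part[OF _ that(4,5) x(2,1)] t(1)[OF that(3)] P(5) P(6)[OF that(4,5)] by auto
  qed
  have lam_v: "z \<in> ?D v \<or> v \<in> ?D z" if "x \<in> ?D v" "x \<in> ?D z" "z \<in> V" "z \<noteq> u" "z \<noteq> v" for x z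
  proof -
    have "x \<in> D u" "x \<in> D z" using that P by auto
    then have "u \<in> D z \<or> z \<in> D u" using tubing_laminar[OF D c(2) that(3)] by blast
    then show ?thesis
      using t(3)[OF that(3), of u] c(3) P(4) P(6)[OF that(4,5)] by auto
  qed
  have uv: "u \<in> ?D v" using P t by simp
  have edge_u: "u \<in> ?D y \<or> y \<in> ?D u" if "E u y" "y \<in> V" "y \<noteq> u" "y \<noteq> v" for y
  proof -
    have "u \<in> D y \<or> y \<in> D u" using tubing_edge[OF D c(2) that(2,1)] .
    moreover have "y \<in> ?K" if "y \<in> D u"
      using component_edge[of u E "D u - {v}" u y] t(1)[OF c(2)] c(4) that \<open>E u y\<close> \<open>y \<noteq> v\<close> by simp
    ultimately show ?thesis using P(5) P(6)[OF that(3,4)] by auto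
  qed
  have edge_v: "v \<in> ?D y \<or> y \<in> ?D v" if "E v y" "y \<in> V" "y \<noteq> u" "y \<noteq> v" for y
    using tubing_edge[OF D c(1) that(2,1)] t(3)[OF c(2,3)] P(4) P(6)[OF that(3,4)] by auto
  show ?thesis unfolding tubing_def
  proof (intro conjI ballI impI)
    fix x assume x: "x \<in> V"
    show "x \<in> ?D x" using x c t by (auto simp: rot_tubing_def)
    show "?D x \<subseteq> V"
      using t(2)[OF x] t(2)[OF c(2)] K(2) unfolding rot_tubing_def by auto
    have "connected_on E ?K" using t(1)[OF c(2)] c(4) by (intro connected_on_component E) auto
    then show "connected_on E (?D x)" using tubing_connected[OF D] x c by (auto simp: rot_tubing_def)
  next
    fix x y assume xy: "x \<in> V" "y \<in> ?D x"
    consider "x = v" | "x = u" | "x \<noteq> v" "x \<noteq> u" by blast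
    then show "?D y \<subseteq> ?D x"
    proof cases
      case 1
      then show ?thesis using xy t(3)[OF c(2)] K P(3) by (auto simp: rot_tubing_def split: if_splits)
    next
      case 2
      then have y: "y \<in> ?K" "y \<noteq> v" using xy P K by auto
      show ?thesis
      proof (cases "y = u")
        case False
        have "y \<in> D u" using y K by blast
        moreover have "y \<in> D y" using \<open>y \<in> D u\<close> t c by blast
        ultimately have "D y \<subseteq> ?K" using rot_tubing_part[OF _ False y(2) _ y(1)] by blast
        then show ?thesis using False 2 y by (simp add: P)
      qed (use 2 in simp)
    next
      case 3
      then have "y \<in> D x" using xy by (simp add: P)
      moreover have "u \<in> D x" if "v \<in> D x" using c(5) 3 xy that by blast
      ultimately show ?thesis using 3 t(3)[OF xy(1)] K(2)
        by (auto simp: rot_tubing_def split: if_splits)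
    qed
    assume yx: "x \<in> ?D y"
    have yV: "y \<in> V" using xy t(2) c K by (auto simp: rot_tubing_def split: if_splits)
    have uother: False if "z \<in> D u" "u \<in> D z" "z \<noteq> u" for z using t(4)[OF c(2) that(1,2)] that by simp
    show "x = y"
    proof (cases "x = u \<or> x = v")
      case True
      show ?thesis
      proof (cases "y = u \<or> y = v")
        case False
        have "y \<in> D u" "u \<in> D y"
          using True False xy(2) yx K c(5)[OF yV] by (auto simp: rot_tubing_def split: if_splits)
        then show ?thesis using uother False by blast
      qed (use True xy yx K P(3) in \<open>auto simp: P\<close>)
    next
      case False
      show ?thesis
      proof (cases "y = u \<or> y = v")
        case True
        have "x \<in> D u" "u \<in> D x"
          using True False xy yx K c(5)[OF xy(1)] by (auto simp: rot_tubing_def split: if_splits)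
        then show ?thesis using uother False by blast
      next
        case F: False
        then show ?thesis using False xy yx t(4)[OF xy(1)] by (simp add: P)
      qed
    qed
  next
    fix x y z assume *: "x \<in> V" "y \<in> V" "z \<in> V" "x \<in> ?D y \<and> x \<in> ?D z"
    show "y \<in> ?D z \<or> z \<in> ?D y"
    proof (cases "y = u \<or> y = v")
      case True
      then show ?thesis
        using lam_u[of x z] lam_v[of x z] uv * t(1) P(4,5) by (metis component_refl c(2,3))
    next
      case False
      then have yy: "y \<noteq> u" "y \<noteq> v" by auto
      show ?thesis
      proof (cases "z = u \<or> z = v")
        case True
        then show ?thesis using lam_u[of x y] lam_v[of x y] * yy by blast
      next
        case F: False
        then show ?thesis using tubing_laminar[OF D *(2,3), of x] *(4) yy by (simp add: P)
      qed
    qed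
  next
    fix x y assume *: "x \<in> V" "y \<in> V" "E x y"
    have yx: "E y x" using * sympD[OF E] by blast
    have "x \<in> ?D x" using * c t by (auto simp: rot_tubing_def)
    then show "x \<in> ?D y \<or> y \<in> ?D x"
    proof (cases "x = u \<or> x = v")
      case True
      then show ?thesis using edge_u edge_v uv * \<open>x \<in> ?D x\<close> by metis
    next
      case False
      then have xx: "x \<noteq> u" "x \<noteq> v" by auto
      show ?thesis
      proof (cases "y = u \<or> y = v")
        case True
        then show ?thesis using edge_u[of x] edge_v[of x] yx xx * by blast
      next
        case F: False
        then show ?thesis using tubing_edge[OF D *] xx by (simp add: P)
      qed
    qed
  qed
qed

section \<open>Parents after a rotation, matched with the clauses of \<open>rotate\<close>\<close>

lemma covered_rot_upper:
  assumes "covered V D u y"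
  shows "covered V (rot_tubing E D u v) v y"
proof -
  note c = coveredD[OF cov] and d = coveredD[OF assms] and P = rot_tubing_props
  note t = tubing_refl[OF D] tubing_subset[OF D] tubing_trans[OF D] tubing_antisym[OF D]
  have yv: "y \<noteq> v" using covered_not_mem[OF D cov] d(3) by blast
  then have Dy: "rot_tubing E D u v y = D y" using d by (intro P) auto
  show ?thesis unfolding covered_def
  proof (intro conjI ballI impI)
    show "v \<in> rot_tubing E D u v y" using Dy t(3)[OF d(2,3)] c(3) by blast
    fix z assume z: "z \<in> V" "v \<in> rot_tubing E D u v z \<and> z \<noteq> v"
    then have "z \<noteq> u" using P(5,7) by auto
    then show "y \<in> rot_tubing E D u v z" using z c(5)[of z] d(5)[of z] P(6) by auto
  qed (use c d yv in auto)
qed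

lemma covered_rot_swap: "covered V (rot_tubing E D u v) u v"
proof -
  note c = coveredD[OF cov] and P = rot_tubing_props
  note t = tubing_refl[OF D] tubing_trans[OF D]
  show ?thesis unfolding covered_def
  proof (intro conjI ballI impI)
    fix z assume z: "z \<in> V" "u \<in> rot_tubing E D u v z \<and> z \<noteq> u"
    show "v \<in> rot_tubing E D u v z" 
      using z P(4) P(6)[of z] c(3) t(2)[OF z(1), of u] by (cases "z = v") auto
  qed (use c t P in auto)
qed

lemma covered_rot_moved:
  assumes x: "covered V D x v" and e: "\<exists>y\<in>D x. E u y"
  shows "covered V (rot_tubing E D u v) x u"
proof -
  note c = coveredD[OF cov] and d = coveredD[OF x] and P = rot_tubing_props
  note t = tubing_refl[OF D] tubing_subset[OF D] tubing_trans[OF D] tubing_antisym[OF D]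
  have xu: "x \<in> D u" using t(3)[OF c(2,3)] d(3) by blast
  have ne: "x \<noteq> u" using covered_not_mem[OF D cov] d(3) by blast
  have Dx: "D x \<subseteq> D u - {v}" using t(3)[OF c(2) xu] rot_tubing_below[OF xu ne d(4)] by blast
  obtain y where y: "y \<in> D x" "E u y" using e by blast
  have "y \<in> component E (D u - {v}) u"
    using component_edge[of u E "D u - {v}" u y] y Dx t(1)[OF c(2)] c(4) by auto
  then have "x \<in> component E (D u - {v}) u"
    using rot_tubing_part[OF xu ne d(4) y(1)] t(1)[OF d(1)] by blast
  then show ?thesis unfolding covered_def
  proof (intro conjI ballI impI)
    fix z assume z: "z \<in> V" "x \<in> rot_tubing E D u v z \<and> z \<noteq> x"
    consider "z = u" | "z = v" | "z \<noteq> u" "z \<noteq> v" by blast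
    then show "u \<in> rot_tubing E D u v z"
    proof cases
      case 3
      then show ?thesis using z d(5)[of z] c(5)[of z] P(6)[of z] by auto
    qed (use P t(1) c in auto)
  qed (use P c d ne in auto)
qed

text \<open>Without an edge to \<open>u\<close>, the tube of \<open>x\<close> is closed in
  \<open>D u - {v}\<close>. The component of \<open>u\<close> there misses \<open>x\<close>, so
  \<open>v\<close> remains the least vertex above \<open>x\<close>.\<close>

lemma covered_rot_unmoved:
  assumes x: "covered V D x v" and e: "\<not> (\<exists>y\<in>D x. E u y)"
  shows "covered V (rot_tubing E D u v) x v"
proof -
  note c = coveredD[OF cov] and d = coveredD[OF x] and P = rot_tubing_props
  note t = tubing_refl[OF D] tubing_subset[OF D] tubing_trans[OF D] tubing_antisym[OF D]
  have xu: "x \<in> D u" using t(3)[OF c(2,3)] d(3) by blast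
  have ne: "x \<noteq> u" using covered_not_mem[OF D cov] d(3) by blast
  have unx: "u \<notin> D x" using t(4)[OF c(2) xu] ne by auto
  have "component E (D u - {v}) x \<subseteq> D x"
  proof (rule component_closed)
    show "x \<in> D x" using t d by blast
    fix y z assume *: "y \<in> D x" "y \<in> D u - {v}" "z \<in> D u - {v}" "E y z"
    have V: "y \<in> V" "z \<in> V" using * t(2)[OF c(2)] by auto
    have zu: "z \<noteq> u" using e * sympD[OF E] by blast
    from tubing_edge[OF D V *(4)] show "z \<in> D x"
    proof
      assume "y \<in> D z"
      then have "x \<in> D z \<or> z \<in> D x" using tubing_laminar[OF D V(2) d(1) _ *(1)] by blast
      moreover have "z = x" if "x \<in> D z"
        using d(5)[OF V(2) that] rot_tubing_below[of z] * zu by blast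
      ultimately show ?thesis using t(1)[OF d(1)] by blast
    qed (use t(3)[OF d(1) *(1)] in blast)
  qed
  then have nK: "x \<notin> component E (D u - {v}) u"
    using component_sym[OF E, of x "D u - {v}" u] unx by blast
  show ?thesis unfolding covered_def
  proof (intro conjI ballI impI)
    fix z assume z: "z \<in> V" "x \<in> rot_tubing E D u v z \<and> z \<noteq> x"
    have "z \<noteq> u" using nK z P by auto
    then show "v \<in> rot_tubing E D u v z" using z P(4) P(6)[of z] d(5)[of z] c(3) by (cases "z = v") auto
  qed (use P c d xu in auto)
qed

text \<open>The delicate case is \<open>y = u\<close>: a sibling of \<open>v\<close> must lie in the
  component of \<open>u\<close> after \<open>v\<close> is deleted, and it does, since its tube
  contains a neighbour of \<open>u\<close>.\<close>

lemma covered_rot_other: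
  assumes x: "covered V D x y" and ne: "x \<noteq> v" "x \<noteq> u" "y \<noteq> v"
  shows "covered V (rot_tubing E D u v) x y"
proof -
  note c = coveredD[OF cov] and d = coveredD[OF x] and P = rot_tubing_props
  note t = tubing_refl[OF D] tubing_subset[OF D] tubing_trans[OF D] tubing_antisym[OF D]
  show ?thesis
  proof (cases "y = u")
    case True
    obtain w where w: "w \<in> D x" "E u w" using covered_edge[OF E D x] True by blast
    have xu: "x \<in> D u" using d True by simp
    have Dx: "D x \<subseteq> D u - {v}" using t(3)[OF c(2) xu] rot_tubing_below[OF xu ne(2,1)] by blast
    have "w \<in> component E (D u - {v}) u"
      using component_edge[of u E "D u - {v}" u w] w Dx t(1)[OF c(2)] c(4) by auto
    then have "x \<in> component E (D u - {v}) u"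
      using rot_tubing_part[OF xu ne(2,1) w(1)] t(1)[OF d(1)] by blast
    then show ?thesis unfolding covered_def
    proof (intro conjI ballI impI)
      fix z assume z: "z \<in> V" "x \<in> rot_tubing E D u v z \<and> z \<noteq> x"
      consider "z = u" | "z = v" | "z \<noteq> u" "z \<noteq> v" by blast
      then show "y \<in> rot_tubing E D u v z"
      proof cases
        case 3
        then show ?thesis using z d(5)[of z] P(6)[of z] by auto
      qed (use P t(1) c True in auto)
    qed (use P c d True in auto)
  next
    case False
    show ?thesis unfolding covered_def
    proof (intro conjI ballI impI)
      show "x \<in> rot_tubing E D u v y" using False ne d P(6) by simp
      fix z assume z: "z \<in> V" "x \<in> rot_tubing E D u v z \<and> z \<noteq> x"
      have *: "y \<in> D u" if "x \<in> D u" using d(5)[OF c(2) that] ne by blast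
      consider "z = u" | "z = v" | "z \<noteq> u" "z \<noteq> v" by blast
      then show "y \<in> rot_tubing E D u v z"
      proof cases
        case 1
        then have xK: "x \<in> component E (D u - {v}) u" using z P by simp
        then have "y \<in> D u" using P(7) * by blast
        then have "D y \<subseteq> component E (D u - {v}) u"
          using rot_tubing_part[OF _ False ne(3) d(3) xK] by blast
        then show ?thesis using 1 P t(1)[OF d(2)] by auto
      next
        case 3
        then show ?thesis using z d(5)[of z] P(6)[of z] by auto
      qed (use P * z in auto)
    qed (use d in auto)
  qed
qed

text \<open>The premise \<open>ex\<close> stands for the existence of parents, which is derived from
  finiteness of \<open>V\<close>; the surrounding context does not assume the latter.\<close>

lemma covered_rot_root:
  assumes "\<not> (\<exists>y. covered V D x y)" "x \<noteq> u" "x \<noteq> v" 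
    and ex: "\<And>x y. x \<in> V \<Longrightarrow> y \<in> V \<Longrightarrow> x \<in> D y \<Longrightarrow> x \<noteq> y \<Longrightarrow> \<exists>y. covered V D x y"
  shows "\<not> covered V (rot_tubing E D u v) x y"
proof
  note c = coveredD[OF cov] and P = rot_tubing_props
  assume *: "covered V (rot_tubing E D u v) x y"
  note d = coveredD[OF *]
  have "\<exists>z\<in>V. x \<in> D z \<and> x \<noteq> z"
    using d(2-4) P(7) c(2) assms(2) unfolding rot_tubing_def by (auto split: if_splits)
  then show False using ex d(1) assms(1) by blast
qed

end

subsection \<open>Search forests as parent maps\<close>

text \<open>Search forests without recursion. Comparability of the ends of every edge is the
  condition on elimination forests known from tree-depth; connectedness of all subtrees singles out
  those that arise by splitting into components.\<close>

definition elimination_forest :: "'a set \<Rightarrow> ('a \<Rightarrow> 'a \<Rightarrow> bool) \<Rightarrow> ('a \<Rightarrow> 'a option) \<Rightarrow> bool" where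
  "elimination_forest V E p \<longleftrightarrow>
     (\<forall>x y. p x = Some y \<longrightarrow> x \<in> V \<and> y \<in> V) \<and> acyclic (par_rel p) \<and>
     (\<forall>x\<in>V. connected_on E (desc p x)) \<and>
     (\<forall>x\<in>V. \<forall>y\<in>V. E x y \<longrightarrow> x \<in> desc p y \<or> y \<in> desc p x)"

section \<open>Descendant sets of parent maps\<close>

lemma desc_refl [simp]: "x \<in> desc p x"
  by (simp add: desc_def)

lemma desc_parent: "p x = Some y \<Longrightarrow> x \<in> desc p y"
  by (auto simp: desc_def par_rel_def)

lemma desc_trans: "y \<in> desc p x \<Longrightarrow> desc p y \<subseteq> desc p x"
  by (auto simp: desc_def)

lemma desc_cases:
  assumes "x \<in> desc p y"
  obtains "x = y" | z where "p x = Some z" "z \<in> desc p y"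
  using assms by (auto simp: desc_def par_rel_def elim: converse_rtranclE)

lemma desc_child_cases:
  assumes "x \<in> desc p y"
  obtains "x = y" | z where "x \<in> desc p z" "p z = Some y"
  using assms by (auto simp: desc_def par_rel_def elim: rtranclE)

lemma desc_induct [consumes 1, case_names base step]:
  assumes "x \<in> desc p y" "P y" 
    "\<And>x z. p x = Some z \<Longrightarrow> z \<in> desc p y \<Longrightarrow> P z \<Longrightarrow> P x"
  shows "P x"
proof -
  have "(x, y) \<in> (par_rel p)\<^sup>*" using assms(1) by (simp add: desc_def)
  then show ?thesis
    by (induction rule: converse_rtrancl_induct) (use assms in \<open>auto simp: desc_def par_rel_def\<close>)
qed

lemma desc_chain:
  assumes "x \<in> desc p y" "x \<in> desc p z"
  shows "y \<in> desc p z \<or> z \<in> desc p y"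
proof -
  have "single_valued (par_rel p)" by (auto simp: single_valued_def par_rel_def)
  then show ?thesis using assms single_valued_confluent unfolding desc_def by fastforce
qed

lemma acyclic_desc_antisym:
  assumes "acyclic (par_rel p)" "x \<in> desc p y" "y \<in> desc p x"
  shows "x = y"
  using acyclic_impl_antisym_rtrancl[OF assms(1)] assms(2,3) by (auto simp: antisym_def desc_def)

lemma acyclic_no_parent_desc:
  assumes "acyclic (par_rel p)" "p x = Some y"
  shows "y \<notin> desc p x"
proof
  assume "y \<in> desc p x"
  moreover have "(x, y) \<in> par_rel p" using assms(2) by (simp add: par_rel_def)
  ultimately have "(x, x) \<in> (par_rel p)\<^sup>+" by (auto simp: desc_def intro: rtrancl_into_trancl2)
  then show False using assms(1) by (simp add: acyclic_def)
qed

lemma desc_subset: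
  assumes "\<And>x y. p x = Some y \<Longrightarrow> x \<in> V" "x \<in> V"
  shows "desc p x \<subseteq> V"
proof
  fix z assume "z \<in> desc p x"
  then show "z \<in> V" by (rule desc_cases) (use assms in auto)
qed

text \<open>The arcs are compared by their upper ends. Hence \<open>q\<close> may cut the arc from
  the root of \<open>C\<close> to a parent outside \<open>C\<close>, as the restricted maps in
  \<open>stree\<close> do.\<close>

lemma desc_cong:
  assumes "\<And>x y. y \<in> C \<Longrightarrow> q x = Some y \<longleftrightarrow> p x = Some y"
    and "\<And>x y. q x = Some y \<Longrightarrow> x \<in> C" and "x \<in> C"
  shows "desc q x = desc p x"
proof -
  have sub: "desc q x \<subseteq> C" using assms(2,3) by (rule desc_subset)
  have "z \<in> desc p x" if "z \<in> desc q x" for z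
    using that
  proof (induction rule: desc_induct)
    case (step z w)
    then have "p z = Some w" using sub assms(1) by blast
    then show ?case using step.IH desc_parent desc_trans by fastforce
  qed simp
  moreover have "z \<in> desc q x" if "z \<in> desc p x" for z
    using that
  proof (induction rule: desc_induct)
    case (step z w)
    then have "q z = Some w" using sub assms(1) by blast
    then show ?case using step.IH desc_parent desc_trans by fastforce
  qed simp
  ultimately show ?thesis by blast
qed

lemma elimination_forest_tubing:
  assumes "elimination_forest V E p"
  shows "tubing V E (desc p)"
  unfolding tubing_def
proof (intro conjI ballI impI)
  note f = assms[unfolded elimination_forest_def]
  show "desc p x \<subseteq> V" if "x \<in> V" for x using desc_subset[of p V x] f that by blast
  show "x = y" if "x \<in> desc p y" "y \<in> desc p x" for x y using acyclic_desc_antisym f that by metis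
  show "y \<in> desc p z \<or> z \<in> desc p y" if "x \<in> desc p y \<and> x \<in> desc p z" for x y z
    using desc_chain that by metis
  show "desc p y \<subseteq> desc p x" if "y \<in> desc p x" for x y using desc_trans[OF that] .
qed (use assms elimination_forest_def in \<open>auto simp: elimination_forest_def\<close>)

lemma elimination_forest_parent_of:
  assumes "elimination_forest V E p"
  shows "parent_of V (desc p) p"
  unfolding parent_of_def
proof (intro allI)
  fix x y
  note f = assms[unfolded elimination_forest_def]
  have cov: "covered V (desc p) x y" if "p x = Some y" for x y
    unfolding covered_def
  proof (intro conjI ballI impI)
    show "x \<in> desc p y" using that by (rule desc_parent)
    show "x \<noteq> y" using acyclic_no_parent_desc[of p x y] that f by auto
    fix z assume "x \<in> desc p z \<and> z \<noteq> x"
    then show "y \<in> desc p z" using that by (auto elim: desc_cases)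
  qed (use f that in auto)
  show "p x = Some y \<longleftrightarrow> covered V (desc p) x y"
  proof
    assume c: "covered V (desc p) x y"
    then obtain z where z: "p x = Some z" unfolding covered_def by (auto elim: desc_cases)
    have "z = y" using covered_unique[OF elimination_forest_tubing[OF assms] cov[OF z] c] .
    then show "p x = Some y" using z by simp
  qed (rule cov)
qed

lemma tubing_covered_ex:
  assumes "finite V" "tubing V E D" "x \<in> V" "y \<in> V" "x \<in> D y" "x \<noteq> y"
  shows "\<exists>y. covered V D x y"
proof -
  let ?A = "{y \<in> V. x \<in> D y \<and> x \<noteq> y}"
  have "finite ?A" "?A \<noteq> {}" using assms by auto
  \<comment> \<open>The parent is found as a vertex above \<open>x\<close> whose tube has least
    cardinality; laminarity turns minimal into least.\<close>
  then obtain y where y: "y \<in> ?A" "\<And>z. z \<in> ?A \<Longrightarrow> card (D y) \<le> card (D z)"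
    using ex_min_if_finite[of "(\<lambda>y. card (D y)) ` ?A"] by (fastforce simp: not_less)
  have "y \<in> D z" if z: "z \<in> V" "x \<in> D z" "z \<noteq> x" for z
  proof -
    have "y \<in> D z \<or> z \<in> D y" using tubing_laminar[OF assms(2) _ z(1) _ z(2)] y(1) by blast
    then show ?thesis
    proof
      assume zy: "z \<in> D y"
      have fin: "finite (D y)" using tubing_subset[OF assms(2)] y(1) assms(1) finite_subset by blast
      have "D z \<subseteq> D y" using tubing_trans[OF assms(2) _ zy] y(1) by blast
      moreover have "card (D y) \<le> card (D z)" using y(2) z by blast
      ultimately have "D z = D y" using fin by (intro card_seteq)
      then show ?thesis using tubing_refl[OF assms(2)] y(1) by blast
    qed
  qed
  then have "covered V D x y" using assms(3) y(1) unfolding covered_def by blast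
  then show ?thesis by blast
qed

lemma parent_of_desc:
  assumes "finite V" "tubing V E D" "parent_of V D p" "x \<in> V"
  shows "desc p x = D x"
proof
  have cov: "p z = Some w \<longleftrightarrow> covered V D z w" for z w using assms(3) by (simp add: parent_of_def)
  note t = tubing_refl[OF assms(2)] tubing_subset[OF assms(2)] tubing_trans[OF assms(2)]
  show "desc p x \<subseteq> D x"
  proof
    fix z assume "z \<in> desc p x"
    then show "z \<in> D x"
    proof (induction rule: desc_induct)
      case (step z w)
      then have "z \<in> D w" using cov coveredD by metis
      then show ?case using t(3)[OF assms(4) step.IH] by blast
    qed (use t assms(4) in simp)
  qed
  have "z \<in> desc p x" if "z \<in> D x" for z
    using that
  \<comment> \<open>This number measures the depth of \<open>z\<close>. It drops on passing to the
    parent: every tube containing the parent contains \<open>z\<close>, and \<open>D z\<close>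
    itself no longer counts.\<close>
  proof (induction "card {w \<in> V. z \<in> D w}" arbitrary: z rule: less_induct)
    case less
    show ?case
    proof (cases "z = x")
      case False
      have z: "z \<in> V" using less.prems t(2) assms(4) by blast
      obtain w where w: "covered V D z w"
        using tubing_covered_ex[OF assms(1,2) z assms(4) less.prems False] by blast
      note c = coveredD[OF w]
      have wx: "w \<in> D x" using c(5)[OF assms(4) less.prems] False by simp
      have "{y \<in> V. w \<in> D y} \<subseteq> {y \<in> V. z \<in> D y}" using c(3) t(3) by blast
      moreover have "z \<in> {y \<in> V. z \<in> D y}" "z \<notin> {y \<in> V. w \<in> D y}"
        using t(1)[OF z] z covered_not_mem[OF assms(2) w] by auto
      ultimately have "{y \<in> V. w \<in> D y} \<subset> {y \<in> V. z \<in> D y}" by blast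
      then have "card {y \<in> V. w \<in> D y} < card {y \<in> V. z \<in> D y}"
        using assms(1) by (intro psubset_card_mono) auto
      then have "w \<in> desc p x" using less.hyps wx by blast
      moreover have "z \<in> desc p w" using w cov desc_parent by metis
      ultimately show ?thesis using desc_trans by fastforce
    qed simp
  qed
  then show "D x \<subseteq> desc p x" by blast
qed

lemma parent_of_elimination_forest:
  assumes "finite V" "tubing V E D" "parent_of V D p"
  shows "elimination_forest V E p"
proof -
  have cov: "p z = Some w \<longleftrightarrow> covered V D z w" for z w using assms(3) by (simp add: parent_of_def)
  have D: "desc p x = D x" if "x \<in> V" for x using parent_of_desc[OF assms that] .
  have "acyclic (par_rel p)"
  proof (intro acyclicI allI notI)
    fix x assume "(x, x) \<in> (par_rel p)\<^sup>+"
    then obtain y where y: "p x = Some y" "y \<in> desc p x"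
      by (auto simp: desc_def par_rel_def dest: tranclD)
    then have c: "covered V D x y" using cov by simp
    then show False using covered_not_mem[OF assms(2) c] y(2) D coveredD(1)[OF c] by simp
  qed
  moreover have "x \<in> V \<and> y \<in> V" if "p x = Some y" for x y
    using that cov coveredD(1,2)[of V D x y] by simp
  ultimately show ?thesis
    using D tubing_connected[OF assms(2)] tubing_edge[OF assms(2)]
    unfolding elimination_forest_def by simp
qed

lemma tubing_parent_map_ex:
  assumes "tubing V E D"
  shows "\<exists>p. parent_of V D p"
proof -
  have "\<forall>x. \<exists>r. \<forall>y. r = Some y \<longleftrightarrow> covered V D x y"
  proof
    fix x
    show "\<exists>r. \<forall>y. r = Some y \<longleftrightarrow> covered V D x y"
    proof (cases "\<exists>y. covered V D x y")
      case True
      then obtain y where y: "covered V D x y" by blast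
      have "Some y = Some z \<longleftrightarrow> covered V D x z" for z
        using y covered_unique[OF assms y, of z] by auto
      then show ?thesis by blast
    qed (auto intro: exI[of _ None])
  qed
  then show ?thesis unfolding parent_of_def by (rule choice)
qed

lemma parent_of_unique:
  assumes "parent_of V D p" "parent_of V D' q" "\<And>x. x \<in> V \<Longrightarrow> D x = D' x"
  shows "p = q"
proof
  fix x
  have "covered V D x y \<longleftrightarrow> covered V D' x y" for y
    using assms(3) unfolding covered_def by (simp cong: conj_cong ball_cong)
  then have "p x = Some y \<longleftrightarrow> q x = Some y" for y using assms by (simp add: parent_of_def)
  then show "p x = q x" by (metis option.exhaust)
qed

lemma elimination_forest_restrict:
  assumes "elimination_forest X E p" "C \<subseteq> X"
    and eq: "\<And>x y. y \<in> C \<Longrightarrow> q x = Some y \<longleftrightarrow> p x = Some y"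
    and q: "\<And>x y. q x = Some y \<Longrightarrow> x \<in> C \<and> y \<in> C"
  shows "elimination_forest C E q"
proof -
  have D: "desc q x = desc p x" if "x \<in> C" for x
    by (rule desc_cong[OF eq _ that]) (use q in blast)+
  have qp: "p x = Some y" if "q x = Some y" for x y
    using that eq[of y x] q[OF that] by blast
  then have "par_rel q \<subseteq> par_rel p" by (auto simp: par_rel_def)
  then have "acyclic (par_rel q)" using assms(1) acyclic_subset by (auto simp: elimination_forest_def)
  moreover have "x \<in> desc q y \<or> y \<in> desc q x" if "x \<in> C" "y \<in> C" "E x y" for x y
  proof -
    have "x \<in> X" "y \<in> X" using that assms(2) by auto
    then show ?thesis using that D assms(1) by (simp add: elimination_forest_def)
  qed
  moreover have "connected_on E (desc q x)" if "x \<in> C" for x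
  proof -
    have "x \<in> X" using that assms(2) by auto
    then show ?thesis using that D assms(1) by (simp add: elimination_forest_def)
  qed
  moreover have "\<forall>x y. q x = Some y \<longrightarrow> x \<in> C \<and> y \<in> C" using q by blast
  ultimately show ?thesis unfolding elimination_forest_def by blast
qed

section \<open>Equivalence with the recursive definition of search trees\<close>

lemma stree_elimination_forest:
  assumes "symp E" "stree E X r p"
  shows "elimination_forest X E p \<and> X \<subseteq> desc p r \<and> p r = None \<and> r \<in> X"
  using assms(2)
proof (induction rule: stree.induct)
  case (1 X r p)
  note conn = 1(2) and rX = 1(3) and none = 1(4) and outside = 1(5) and inside = 1(6) and IH = 1(7)
  let ?q = "\<lambda>C v. if v \<in> C \<and> p v \<noteq> Some r then p v else None"
  let ?C = "component E (X - {r})"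
  have comp: "?C x \<subseteq> X - {r}" if "x \<in> X - {r}" for x
    using component_subset that by metis
  have q: "elimination_forest (?C x) E (?q (?C x)) \<and> (\<exists>c \<in> ?C x. ?C x \<subseteq> desc (?q (?C x)) c \<and> ?q (?C x) c = None)"
    if "x \<in> X - {r}" for x
  proof -
    have "?C x \<in> comps E (X - {r})" using that by (auto simp: comps_eq_components)
    from IH[rule_format, OF this] show ?thesis by blast
  qed
  have par: "y = r \<or> y \<in> ?C x" "x \<in> X - {r}" if "p x = Some y" for x y
  proof -
    have "x \<in> X" "x \<noteq> r" using that none outside by (metis option.distinct(1))+
    then show x: "x \<in> X - {r}" by simp
    have "?q (?C x) x = Some y" if "y \<noteq> r" using that \<open>p x = Some y\<close> by simp
    then show "y = r \<or> y \<in> ?C x" using q[OF x] unfolding elimination_forest_def by blast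
  qed
  have eqC: "?C y = ?C x" if "y \<in> ?C x" for x y using component_eq[OF assms(1) that] .
  have D: "desc (?q (?C x)) y = desc p y" if "x \<in> X - {r}" "y \<in> ?C x" for x y
  proof (rule desc_cong[OF _ _ that(2)])
    fix z w assume w: "w \<in> ?C x"
    have wr: "w \<noteq> r" using w comp[OF that(1)] by blast
    show "?q (?C x) z = Some w \<longleftrightarrow> p z = Some w"
    proof
      assume "p z = Some w"
      then have "w \<in> ?C z" using par wr by blast
      then have "?C z = ?C x" using eqC[of w z] eqC[of w x] w by simp
      then have "z \<in> ?C x" using component_refl[of z E "X - {r}"] by simp
      then show "?q (?C x) z = Some w" using \<open>p z = Some w\<close> wr by simp
    qed (auto split: if_splits)
  qed (auto split: if_splits)
  have Dsub: "desc p y \<subseteq> ?C y" if "y \<in> X - {r}" for y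
  proof -
    have "desc (?q (?C y)) y \<subseteq> ?C y" by (rule desc_subset) (auto split: if_splits)
    then show ?thesis using D[OF that component_refl] by simp
  qed
  have root: "x \<in> desc p r" if "x \<in> X" for x
  proof (cases "x = r")
    case False
    then have x: "x \<in> X - {r}" using that by simp
    obtain c where c: "c \<in> ?C x" "?C x \<subseteq> desc (?q (?C x)) c" "?q (?C x) c = None" using q[OF x] by blast
    have "c \<in> X - {r}" using comp[OF x] c by blast
    then have "p c \<noteq> None" using inside by simp
    \<comment> \<open>The root \<open>c\<close> of the subtree has a parent in \<open>p\<close> but
      none in the restricted map, and on \<open>?C x\<close> the restriction drops only arcs into
      \<open>r\<close>.\<close>
    then have "p c = Some r" using c by (auto split: if_splits)
    moreover have "x \<in> desc p c" using c D[OF x c(1)] component_refl by fastforce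
    ultimately show ?thesis using desc_parent desc_trans by fastforce
  qed simp
  have "acyclic (par_rel p)"
  proof (intro acyclicI allI notI)
    fix x assume cyc: "(x, x) \<in> (par_rel p)\<^sup>+"
    then obtain y where y: "p x = Some y" "y \<in> desc p x"
      by (auto simp: desc_def par_rel_def dest: tranclD)
    have x: "x \<in> X - {r}" using par y by blast
    then have "y \<in> ?C x" using Dsub y by blast
    then have "y \<noteq> r" using comp x by blast
    then have "?q (?C x) x = Some y" using y by simp
    moreover have "y \<in> desc (?q (?C x)) x" using D[OF x component_refl] y by simp
    ultimately show False
      using acyclic_no_parent_desc[of "?q (?C x)" x y] q[OF x] unfolding elimination_forest_def by blast
  qed
  moreover have "connected_on E (desc p x)" if "x \<in> X" for x
  proof (cases "x = r")
    case True
    have "desc p r \<subseteq> X" using par(2) rX by (intro desc_subset) blast+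
    then have "desc p r = X" using root by blast
    then show ?thesis using True conn by simp
  next
    case False
    then have x: "x \<in> X - {r}" using that by simp
    have "connected_on E (desc (?q (?C x)) x)"
      using q[OF x] component_refl[of x E "X - {r}"] unfolding elimination_forest_def by blast
    then show ?thesis using D[OF x component_refl] by simp
  qed
  moreover have "x \<in> desc p y \<or> y \<in> desc p x" if "x \<in> X" "y \<in> X" "E x y" for x y
  proof (cases "x = r \<or> y = r")
    case False
    then have x: "x \<in> X - {r}" "y \<in> X - {r}" using that by auto
    then have y: "y \<in> ?C x" using component_edge[of x E "X - {r}" x y] that by simp
    have "x \<in> desc (?q (?C x)) y \<or> y \<in> desc (?q (?C x)) x"
      using q[OF x(1)] y that(3) component_refl[of x E "X - {r}"] unfolding elimination_forest_def by blast
    then show ?thesis using D[OF x(1) y] D[OF x(1) component_refl] by simp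
  qed (use root that in auto)
  moreover have "x \<in> X \<and> y \<in> X" if "p x = Some y" for x y
    using par[OF that] comp[of x] rX by blast
  ultimately have "elimination_forest X E p" unfolding elimination_forest_def by blast
  then show ?case using root none rX by blast
qed

lemma elimination_forest_stree:
  assumes "symp E"
  shows "finite X \<Longrightarrow> connected_on E X \<Longrightarrow> elimination_forest X E p \<Longrightarrow> \<exists>r\<in>X. stree E X r p"
proof (induction "card X" arbitrary: X p rule: less_induct)
  case less
  note f = less.prems(3)[unfolded elimination_forest_def]
  have tub: "tubing X E (desc p)" and par: "parent_of X (desc p) p"
    using elimination_forest_tubing elimination_forest_parent_of less.prems(3) by auto
  note t = tubing_subset[OF tub] tubing_edge[OF tub]
  have "X \<noteq> {}" using less.prems(2) by (simp add: connected_on_def)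
  \<comment> \<open>The root is recovered as a vertex with a largest subtree; connectedness of
    \<open>X\<close> then makes this subtree all of \<open>X\<close>.\<close>
  then obtain r where r: "r \<in> X" "\<And>y. y \<in> X \<Longrightarrow> card (desc p y) \<le> card (desc p r)"
    using Max_in[of "(\<lambda>y. card (desc p y)) ` X"] Max_ge[of "(\<lambda>y. card (desc p y)) ` X"] less.prems(1)
    by (smt (verit) finite_imageI image_iff image_is_empty)
  have none: "p r = None"
  proof (rule ccontr)
    assume "p r \<noteq> None"
    then obtain y where y: "p r = Some y" by blast
    then have "y \<in> X" using f by blast
    moreover have "r \<in> desc p y" "y \<notin> desc p r" using desc_parent[of p r y] acyclic_no_parent_desc[of p r y] y f by auto
    then have "desc p r \<subset> desc p y" using desc_trans desc_refl by fast
    moreover have "finite (desc p y)" using t(1) \<open>y \<in> X\<close> less.prems(1) finite_subset by blast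
    ultimately have "card (desc p r) < card (desc p y)" using psubset_card_mono by blast
    then show False using r(2)[OF \<open>y \<in> X\<close>] by simp
  qed
  have "component E X r \<subseteq> desc p r"
  proof (rule component_closed)
    fix y z assume *: "y \<in> desc p r" "y \<in> X" "z \<in> X" "E y z"
    have "y \<in> desc p z \<or> z \<in> desc p y" using t(2) * by blast
    then show "z \<in> desc p r"
    proof
      assume "y \<in> desc p z"
      then have "z \<in> desc p r \<or> r \<in> desc p z" using desc_chain *(1) by metis
      then show ?thesis using none by (auto elim: desc_cases)
    qed (use desc_trans[OF *(1)] in blast)
  qed simp
  then have root: "X = desc p r" using t(1)[OF r(1)] connected_on_iff_component[OF assms r(1)] less.prems(2) by blast
  have sub: "\<exists>c\<in>C. stree E C c (\<lambda>v. if v \<in> C \<and> p v \<noteq> Some r then p v else None)"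
    if "C \<in> comps E (X - {r})" for C
  proof -
    let ?q = "\<lambda>v. if v \<in> C \<and> p v \<noteq> Some r then p v else None"
    obtain x where x: "x \<in> X - {r}" "C = component E (X - {r}) x"
      using \<open>C \<in> _\<close> by (auto simp: comps_eq_components)
    have "x \<in> desc p r" using x root by blast
    then obtain c where c: "x \<in> desc p c" "p c = Some r" using x by (auto elim: desc_child_cases)
    have cov: "covered X (desc p) c r" using par c by (simp add: parent_of_def)
    have cc: "component E (X - {r}) c = desc p c" using covered_component[OF assms tub cov] root by simp
    then have C: "C = desc p c" using x component_eq[OF assms, of x "X - {r}" c] c(1) by simp
    have CX: "C \<subseteq> X - {r}" using x component_subset[of x "X - {r}" E] by simp
    have "elimination_forest C E ?q"
    proof (rule elimination_forest_restrict[OF less.prems(3)])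
      fix z w assume w: "w \<in> C"
      show "?q z = Some w \<longleftrightarrow> p z = Some w"
      proof
        assume z: "p z = Some w"
        then have "z \<in> C" using w C desc_parent desc_trans by fast
        then show "?q z = Some w" using z w CX by auto
      qed (auto split: if_splits)
    next
      fix z w assume "?q z = Some w"
      then have z: "z \<in> C" "p z = Some w" "w \<noteq> r" by (auto split: if_splits)
      then have "w \<in> desc p c" using C c(2) by (auto elim: desc_cases)
      then show "z \<in> C \<and> w \<in> C" using z C by simp
    qed (use CX in blast)
    moreover have "card C < card X"
      using CX r(1) less.prems(1) by (intro psubset_card_mono) auto
    moreover have "finite C" using CX less.prems(1) finite_subset by blast
    moreover have "connected_on E C" using f C CX coveredD(1)[OF cov] by blast
    ultimately show ?thesis using less.hyps by blast
  qed
  have "p v \<noteq> None" if "v \<in> X - {r}" for v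
  proof -
    have "v \<in> desc p r" using that root by blast
    then show ?thesis using that by (auto elim: desc_cases)
  qed
  moreover have "p v = None" if "v \<notin> X" for v using f that by (cases "p v") auto
  ultimately have "stree E X r p" using less.prems r(1) none sub by (intro stree.intros) auto
  then show ?case using r(1) by blast
qed

text \<open>Both directions work on one component of \<open>V\<close> at a time. From right to left
  this is legitimate because subtrees are connected, so no arc joins two different
  components.\<close>

lemma sforest_iff_elimination_forest:
  assumes "finite V" "symp E"
  shows "sforest V E p \<longleftrightarrow> elimination_forest V E p"
proof
  let ?q = "\<lambda>C v. if v \<in> C then p v else None"
  assume sf: "sforest V E p"
  let ?C = "component E V"
  have q: "elimination_forest (?C x) E (?q (?C x))" if "x \<in> V" for x
  proof -
    have "?C x \<in> comps E V" using that by (auto simp: comps_eq_components)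
    then obtain r where "stree E (?C x) r (?q (?C x))" using sf unfolding sforest_def by blast
    then show ?thesis using stree_elimination_forest[OF assms(2)] by blast
  qed
  have par: "x \<in> V" "y \<in> ?C x" if "p x = Some y" for x y
  proof -
    show x: "x \<in> V" using sf that unfolding sforest_def by (metis option.distinct(1))
    have "?q (?C x) x = Some y" using that by simp
    then show "y \<in> ?C x" using q[OF x] unfolding elimination_forest_def by blast
  qed
  have D: "desc (?q (?C x)) y = desc p y" if "x \<in> V" "y \<in> ?C x" for x y
  proof (rule desc_cong[OF _ _ that(2)])
    fix z w assume w: "w \<in> ?C x"
    show "?q (?C x) z = Some w \<longleftrightarrow> p z = Some w"
    proof
      assume "p z = Some w"
      then have "w \<in> ?C z" using par by blast
      then have "?C z = ?C x" using component_eq[OF assms(2), of w V] w by metis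
      then have "z \<in> ?C x" using component_refl[of z E V] by simp
      then show "?q (?C x) z = Some w" using \<open>p z = Some w\<close> by simp
    qed (auto split: if_splits)
  qed (auto split: if_splits)
  have "acyclic (par_rel p)"
  proof (intro acyclicI allI notI)
    fix x assume cyc: "(x, x) \<in> (par_rel p)\<^sup>+"
    then obtain y where y: "p x = Some y" "y \<in> desc p x"
      by (auto simp: desc_def par_rel_def dest: tranclD)
    have x: "x \<in> V" using par y by blast
    have "?q (?C x) x = Some y" using y by simp
    moreover have "y \<in> desc (?q (?C x)) x" using D[OF x component_refl] y by simp
    ultimately show False
      using acyclic_no_parent_desc[of "?q (?C x)" x y] q[OF x] unfolding elimination_forest_def by blast
  qed
  moreover have "connected_on E (desc p x)" if x: "x \<in> V" for x
  proof -
    have "connected_on E (desc (?q (?C x)) x)"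
      using q[OF x] component_refl[of x E V] unfolding elimination_forest_def by blast
    then show ?thesis using D[OF x component_refl] by simp
  qed
  moreover have "x \<in> desc p y \<or> y \<in> desc p x" if "x \<in> V" "y \<in> V" "E x y" for x y
  proof -
    have y: "y \<in> ?C x" using component_edge[of x E V x y] that by simp
    have "x \<in> desc (?q (?C x)) y \<or> y \<in> desc (?q (?C x)) x"
      using q[OF that(1)] y that(3) component_refl[of x E V] unfolding elimination_forest_def by blast
    then show ?thesis using D[OF that(1) y] D[OF that(1) component_refl] by simp
  qed
  moreover have "x \<in> V \<and> y \<in> V" if "p x = Some y" for x y
    using par[OF that] component_subset[of x V E] by blast
  ultimately show "elimination_forest V E p" unfolding elimination_forest_def by blast
next
  assume ef: "elimination_forest V E p"
  note f = ef[unfolded elimination_forest_def]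
  have tub: "tubing V E (desc p)" using elimination_forest_tubing[OF ef] .
  have "\<exists>r\<in>C. stree E C r (\<lambda>v. if v \<in> C then p v else None)" if "C \<in> comps E V" for C
  proof -
    obtain x where x: "x \<in> V" "C = component E V x"
      using \<open>C \<in> comps E V\<close> unfolding comps_eq_components by blast
    have CV: "C \<subseteq> V" using x component_subset by simp
    have dC: "z \<in> C \<longleftrightarrow> y \<in> C" if "p z = Some y" for y z
    proof -
      have y: "y \<in> V" using f that by blast
      have "desc p y \<subseteq> component E V y"
        by (rule connected_subset_component[OF tubing_connected[OF tub y] _ tubing_subset[OF tub y]]) simp
      then have zy: "z \<in> component E V y" using desc_parent[of p z y] that by blast
      then have "component E V z = component E V y" using component_eq[OF assms(2)] by metis
      then show ?thesis unfolding x(2)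
        using component_sym[OF assms(2), of _ V x] component_sym[OF assms(2), of x V] by blast
    qed
    have "elimination_forest C E (\<lambda>v. if v \<in> C then p v else None)"
      by (rule elimination_forest_restrict[OF ef CV]) (use dC in \<open>auto split: if_splits\<close>)
    moreover have "connected_on E C" using connected_on_component[OF assms(2) x(1)] x(2) by simp
    ultimately show ?thesis using elimination_forest_stree[OF assms(2)] CV assms(1) finite_subset by blast
  qed
  moreover have "p v = None" if "v \<notin> V" for v using f that by (cases "p v") auto
  ultimately show "sforest V E p" unfolding sforest_def by blast
qed

section \<open>Search forests as tubings, and their rotations\<close>

lemma sforest_tubing:
  assumes "finite V" "symp E" "sforest V E p"
  shows "tubing V E (desc p)" "parent_of V (desc p) p"
  using assms elimination_forest_tubing elimination_forest_parent_of sforest_iff_elimination_forest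
  by blast+

lemma sforest_eqI:
  assumes "finite V" "symp E" "sforest V E p" "sforest V E q" "\<And>x. x \<in> V \<Longrightarrow> desc p x = desc q x"
  shows "p = q"
  using parent_of_unique sforest_tubing[OF assms(1,2)] assms(3-5) by metis

lemma parent_of_sforest:
  assumes "finite V" "symp E" "tubing V E D" "parent_of V D p"
  shows "sforest V E p" "x \<in> V \<Longrightarrow> desc p x = D x"
  using parent_of_elimination_forest[OF assms(1,3,4)] parent_of_desc[OF assms(1,3,4)]
    sforest_iff_elimination_forest[OF assms(1,2)] by auto

lemma tubing_sforest_ex:
  assumes "finite V" "symp E" "tubing V E D"
  shows "\<exists>p. sforest V E p \<and> (\<forall>x\<in>V. desc p x = D x)"
  using tubing_parent_map_ex[OF assms(3)] parent_of_sforest[OF assms] by blast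

lemma sforest_covered:
  assumes "finite V" "symp E" "sforest V E p"
  shows "p v = Some u \<longleftrightarrow> covered V (desc p) v u"
  using sforest_tubing(2)[OF assms] by (simp add: parent_of_def)

text \<open>Every arc of the rotated map is a covering pair by inspection of the clauses.
  Conversely, uniqueness of covers leaves only the vertices without a parent in the rotated map:
  apart from \<open>v\<close>, when \<open>u\<close> was a root, these were roots already.\<close>

lemma rotate_parent_of:
  assumes "finite V" "symp E" "sforest V E p" "p v = Some u"
  shows "parent_of V (rot_tubing E (desc p) u v) (rotate E p u v)"
proof -
  let ?D = "rot_tubing E (desc p) u v"
  note tub = sforest_tubing(1)[OF assms(1-3)]
  have par: "p x = Some y \<longleftrightarrow> covered V (desc p) x y" for x y
    using sforest_covered[OF assms(1-3)] .
  then have cov: "covered V (desc p) v u" using assms(4) by simp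
  note R = assms(2) tub cov
  have ne: "u \<noteq> v" using coveredD(4)[OF cov] by simp
  have fwd: "covered V ?D x y" if "rotate E p u v x = Some y" for x y
  proof -
    consider "x = v" | "x = u" "x \<noteq> v" | "x \<noteq> u" "x \<noteq> v" by blast
    then show ?thesis
    proof cases
      case 1
      then have "covered V (desc p) u y" using that par by (simp add: rotate_def)
      then show ?thesis using covered_rot_upper[OF R] 1 by simp
    next
      case 2
      then show ?thesis using that covered_rot_swap[OF R] by (simp add: rotate_def)
    next
      case 3
      show ?thesis
      proof (cases "p x = Some v")
        case True
        then have x: "covered V (desc p) x v" using par by simp
        show ?thesis
        proof (cases "\<exists>y\<in>desc p x. E u y")
          case e: True
          then have "y = u" using that True 3 by (simp add: rotate_def)
          then show ?thesis using covered_rot_moved[OF R x e] by simp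
        next
          case e: False
          then have "y = v" using that True 3 by (auto simp: rotate_def)
          then show ?thesis using covered_rot_unmoved[OF R x e] by simp
        qed
      next
        case False
        then have "p x = Some y" using that 3 by (simp add: rotate_def)
        then show ?thesis using covered_rot_other[OF R, of x y] 3 False par by auto
      qed
    qed
  qed
  have "rotate E p u v x = Some y" if c: "covered V ?D x y" for x y
  proof (cases "rotate E p u v x")
    case (Some z)
    then have "z = y" using covered_unique[OF tubing_rot[OF R] fwd c] by simp
    then show ?thesis using Some by simp
  next
    case None
    have cx: "covered V (desc p) a b \<Longrightarrow> p a \<noteq> None" for a b using par[of a b] by simp
    consider "x = v" | "x = u" "x \<noteq> v" | "x \<noteq> u" "x \<noteq> v" by blast
    then show ?thesis
    proof cases
      case 1
      then have pu: "p u = None" using None by (simp add: rotate_def)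
      have d: "y \<in> V" "v \<in> ?D y" "v \<noteq> y" using coveredD[OF c] 1 by auto
      have yu: "y \<noteq> u" using d(2) rot_tubing_props(5,7)[OF R] by auto
      then have "v \<in> desc p y" using d rot_tubing_props(6)[OF R, of y] by auto
      then have "u \<in> desc p y" using coveredD(5)[OF cov d(1)] d(3) by simp
      then have False using yu pu by (auto elim: desc_cases)
      then show ?thesis ..
    next
      case 3
      then have "p x = None" using None by (auto simp: rotate_def split: if_splits)
      then have "\<not> (\<exists>y. covered V (desc p) x y)" using cx by blast
      then show ?thesis
        using covered_rot_root[OF R _ 3] tubing_covered_ex[OF assms(1) tub] c by metis
    qed (use None in \<open>simp add: rotate_def\<close>)
  qed
  then show ?thesis unfolding parent_of_def using fwd by blast
qed

lemma sforest_rotate: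
  assumes "finite V" "symp E" "sforest V E p" "p v = Some u"
  shows "sforest V E (rotate E p u v)"
    and "x \<in> V \<Longrightarrow> desc (rotate E p u v) x = rot_tubing E (desc p) u v x"
proof -
  have "covered V (desc p) v u" using sforest_covered[OF assms(1-3)] assms(4) by simp
  note t = tubing_rot[OF assms(2) sforest_tubing(1)[OF assms(1-3)] this]
  show "sforest V E (rotate E p u v)"
    "x \<in> V \<Longrightarrow> desc (rotate E p u v) x = rot_tubing E (desc p) u v x"
    using parent_of_sforest[OF assms(1,2) t rotate_parent_of[OF assms]] by auto
qed

text \<open>Rotating back gives \<open>v\<close> the component of \<open>v\<close> in
  \<open>desc p u - {u}\<close>, which is its old tube by \<open>covered_component\<close>.\<close>

lemma rotate_rotate:
  assumes "finite V" "symp E" "sforest V E p" "p v = Some u"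
  shows "rotate E p u v u = Some v" "rotate E (rotate E p u v) v u = p"
proof -
  let ?q = "rotate E p u v"
  note tub = sforest_tubing(1)[OF assms(1-3)]
  have cov: "covered V (desc p) v u" using sforest_covered[OF assms(1-3)] assms(4) by simp
  note c = coveredD[OF cov] and P = rot_tubing_props[OF assms(2) tub cov]
  show q: "?q u = Some v" using c by (simp add: rotate_def)
  note q2 = sforest_rotate[OF assms]
  note q3 = sforest_rotate[OF assms(1,2) q2(1) q]
  have "desc (rotate E ?q v u) x = desc p x" if x: "x \<in> V" for x
  proof -
    consider "x = u" | "x = v" | "x \<noteq> u" "x \<noteq> v" by blast
    then show ?thesis
    proof cases
      case 2
      then show ?thesis
        using q3(2)[OF x] q2(2)[OF c(1)] P c covered_component[OF assms(2) tub cov] by (simp add: rot_tubing_def)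
    qed (use q3(2)[OF x] q2(2)[OF x] q2(2)[OF c(1)] P c in \<open>auto simp: rot_tubing_def\<close>)
  qed
  then show "rotate E ?q v u = p" using sforest_eqI[OF assms(1,2) q3(1) assms(3)] by blast
qed

lemma is_rotation_sym:
  assumes "finite V" "symp E" "sforest V E p" "is_rotation E p q"
  shows "is_rotation E q p"
  using assms(4) rotate_rotate[OF assms(1-3)] unfolding is_rotation_def by metis

text \<open>Rotations preserve search forests and are reversible, so the symmetric disjunction in
  \<open>rot_edge\<close> reduces to one direction.\<close>

lemma rot_edge_iff:
  assumes "finite V" "symp E"
  shows "(p, q) \<in> rot_edge V E \<longleftrightarrow> sforest V E p \<and> is_rotation E p q"
proof
  assume "(p, q) \<in> rot_edge V E"
  then show "sforest V E p \<and> is_rotation E p q"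
    using is_rotation_sym[OF assms] by (auto simp: rot_edge_def)
next
  assume a: "sforest V E p \<and> is_rotation E p q"
  then have "sforest V E q" using sforest_rotate(1)[OF assms] unfolding is_rotation_def by blast
  then show "(p, q) \<in> rot_edge V E" using a by (simp add: rot_edge_def)
qed

subsection \<open>Projection to a spanning subgraph\<close>

lemma component_delete_outside:
  assumes "v \<notin> component E X u" "u \<in> X"
  shows "component E (X - {v}) u = component E X u"
  by (rule component_restrict) (use assms component_subset[OF assms(2), of E] in auto)

text \<open>A relation, because the projected forest is specified only through its tubes;
  \<open>projects_ex\<close> and \<open>projects_unique\<close> make it a function on search
  forests.\<close>

definition projects :: "'a set \<Rightarrow> ('a \<Rightarrow> 'a \<Rightarrow> bool) \<Rightarrow> ('a \<Rightarrow> 'a option) \<Rightarrow> ('a \<Rightarrow> 'a option) \<Rightarrow> bool" where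
  "projects V F p p' \<longleftrightarrow> sforest V F p' \<and> (\<forall>x\<in>V. desc p' x = component F (desc p x) x)"

context
  fixes V :: "'a set" and E F :: "'a \<Rightarrow> 'a \<Rightarrow> bool"
  assumes fin: "finite V" and E: "symp E" and F: "symp F" and FE: "\<And>x y. F x y \<Longrightarrow> E x y"
begin

lemma projects_ex: "sforest V E p \<Longrightarrow> \<exists>p'. projects V F p p'"
  unfolding projects_def
  using tubing_sforest_ex[OF fin F tubing_project[OF F FE sforest_tubing(1)[OF fin E]]] .

lemma projects_unique: "projects V F p p' \<Longrightarrow> projects V F p q' \<Longrightarrow> p' = q'"
  unfolding projects_def by (intro sforest_eqI[OF fin F]) auto

lemma projects_subset: "projects V F p p' \<Longrightarrow> x \<in> V \<Longrightarrow> desc p' x \<subseteq> desc p x"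
  unfolding projects_def using component_subset[of x "desc p x" F] by simp

text \<open>Since \<open>v\<close> is a child of \<open>u\<close> in the projection too, both lie in
  one \<open>F\<close>-component of \<open>desc p u\<close>. For the new tube of \<open>u\<close> it
  does not matter whether \<open>v\<close> is deleted before or after passing to that
  component.\<close>

lemma projects_rotate_both:
  assumes p: "sforest V E p" and p': "projects V F p p'" and pv: "p v = Some u" "p' v = Some u"
  shows "projects V F (rotate E p u v) (rotate F p' u v)"
proof -
  have sf: "sforest V F p'" using p' by (simp add: projects_def)
  note q = sforest_rotate[OF fin E p pv(1)] and q' = sforest_rotate[OF fin F sf pv(2)]
  note c = coveredD[OF sforest_covered[THEN iffD1, OF fin E p pv(1)]]
  let ?X = "desc p u"
  have Du: "desc p' u = component F ?X u" using p' c by (simp add: projects_def)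
  have vX: "v \<in> component F ?X u" using desc_parent[of p' v u] pv Du by simp
  have "desc (rotate F p' u v) x = component F (desc (rotate E p u v) x) x" if x: "x \<in> V" for x
  proof -
    consider "x = v" | "x = u" "x \<noteq> v" | "x \<noteq> u" "x \<noteq> v" by blast
    then show ?thesis
    proof cases
      case 1
      then show ?thesis
        using q(2)[OF x] q'(2)[OF x] Du component_eq[OF F vX] c by (simp add: rot_tubing_def)
    next
      case 2
      have u: "u \<in> ?X - {v}" using c by simp
      have "component F (component F ?X u - {v}) u = component F (?X - {v}) u"
      proof (rule component_restrict[OF _ _ u])
        show "component F (?X - {v}) u \<subseteq> component F ?X u - {v}"
          using component_mono[of "?X - {v}" ?X F F u] component_subset[OF u, of F] by blast
      qed (use component_subset[of u ?X F] in auto)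
      moreover have "component F (component E (?X - {v}) u) u = component F (?X - {v}) u"
        using component_component[OF FE u] .
      ultimately show ?thesis using 2 q(2)[OF x] q'(2)[OF x] Du by (simp add: rot_tubing_def)
    next
      case 3
      then show ?thesis using q(2)[OF x] q'(2)[OF x] p' x by (simp add: rot_tubing_def projects_def)
    qed
  qed
  then show ?thesis using q'(1) by (simp add: projects_def)
qed

text \<open>If \<open>F\<close> joined \<open>u\<close> and \<open>v\<close> inside
  \<open>desc p u\<close>, then \<open>v\<close> would be a child of \<open>u\<close> in the
  projection as well. So they are separated, deleting either one leaves the
  \<open>F\<close>-component of the other intact, and the rotation is invisible after
  projecting.\<close>

lemma projects_rotate_lower:
  assumes p: "sforest V E p" and p': "projects V F p p'" and pv: "p v = Some u" "p' v \<noteq> Some u"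
  shows "projects V F (rotate E p u v) p'"
proof -
  have sf: "sforest V F p'" using p' by (simp add: projects_def)
  have D': "desc p' x = component F (desc p x) x" if "x \<in> V" for x using p' that by (simp add: projects_def)
  note q = sforest_rotate[OF fin E p pv(1)]
  note tub = sforest_tubing(1)[OF fin E p]
  have cov: "covered V (desc p) v u" using sforest_covered[THEN iffD1, OF fin E p pv(1)] .
  note c = coveredD[OF cov]
  let ?X = "desc p u"
  have vX: "v \<notin> component F ?X u"
  proof
    assume v: "v \<in> component F ?X u"
    have "covered V (desc p') v u" unfolding covered_def
    proof (intro conjI ballI impI)
      fix z assume z: "z \<in> V" "v \<in> desc p' z \<and> z \<noteq> v"
      have "v \<in> desc p z" using projects_subset[OF p' z(1)] z(2) by blast
      then have "u \<in> desc p z" using c(5)[OF z(1)] z(2) by blast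
      then have "component F ?X v \<subseteq> component F (desc p z) v" by (intro component_mono desc_trans)
      moreover have "u \<in> component F ?X v" using component_sym[OF F v] .
      moreover have "component F (desc p z) v = component F (desc p z) z"
        using component_eq[OF F] z D' by simp
      ultimately show "u \<in> desc p' z" using D'[OF z(1)] by blast
    qed (use c v D' in auto)
    then show False using sforest_covered[OF fin F sf] pv(2) by simp
  qed
  have uX: "u \<notin> component F ?X v" using component_sym[OF F, of u ?X v] vX by blast
  have "desc p' x = component F (desc (rotate E p u v) x) x" if x: "x \<in> V" for x
  proof -
    consider "x = v" | "x = u" "x \<noteq> v" | "x \<noteq> u" "x \<noteq> v" by blast
    then show ?thesis
    proof cases
      case 1
      have "component F ?X v = component F (?X - {u}) v"
        using component_delete_outside[OF uX c(3)] by simp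
      also have "\<dots> = component F (component E (?X - {u}) v) v"
        by (rule component_component[OF FE, symmetric]) (use c in simp_all)
      also have "\<dots> = component F (desc p v) v" using covered_component[OF E tub cov] by simp
      finally show ?thesis using 1 q(2)[OF x] D'[OF x] c(4) by (simp add: rot_tubing_def)
    next
      case 2
      have "component F (component E (?X - {v}) u) u = component F (?X - {v}) u"
        by (rule component_component[OF FE]) (use c in simp_all)
      also have "\<dots> = component F ?X u" by (rule component_delete_outside[OF vX]) simp
      finally show ?thesis using 2 q(2)[OF x] D'[OF x] by (simp add: rot_tubing_def)
    next
      case 3
      then show ?thesis using q(2)[OF x] D'[OF x] by (simp add: rot_tubing_def)
    qed
  qed
  then show ?thesis using sf by (simp add: projects_def)
qed

text \<open>Used for its contrapositive: if no path joins the projections, then no path joins the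
  original forests.\<close>

lemma projects_rot_path:
  assumes "(p, q) \<in> (rot_edge V E)\<^sup>*" "projects V F p p'"
  shows "\<exists>q'. projects V F q q' \<and> (p', q') \<in> (rot_edge V F)\<^sup>*"
  using assms
proof (induction rule: rtrancl_induct)
  case (step r q)
  then obtain r' where r': "projects V F r r'" "(p', r') \<in> (rot_edge V F)\<^sup>*" by blast
  obtain u v where uv: "sforest V E r" "r v = Some u" "q = rotate E r u v"
    using step.hyps(2) rot_edge_iff[OF fin E] by (auto simp: is_rotation_def)
  show ?case
  proof (cases "r' v = Some u")
    case True
    have "(r', rotate F r' u v) \<in> rot_edge V F"
      using True r'(1) rot_edge_iff[OF fin F] unfolding is_rotation_def projects_def by blast
    then show ?thesis
      using projects_rotate_both[OF uv(1) r'(1) uv(2) True] uv(3) r'(2) by (meson rtrancl_into_rtrancl)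
  next
    case False
    then show ?thesis using projects_rotate_lower[OF uv(1) r'(1) uv(2)] uv(3) r'(2) by blast
  qed
qed blast

end

subsection \<open>Relabelling by an involution\<close>

text \<open>Conjugation of the parent map by \<open>s\<close>. The same \<open>s\<close> is applied
  to argument and value, so this is the usual relabelling when \<open>s\<close> is an
  involution.\<close>

definition relabel :: "('a \<Rightarrow> 'a) \<Rightarrow> ('a \<Rightarrow> 'a option) \<Rightarrow> ('a \<Rightarrow> 'a option)" where
  "relabel s p = (\<lambda>x. map_option s (p (s x)))"

lemma relabel_eq_Some:
  assumes "\<And>x. s (s x) = x"
  shows "relabel s p x = Some y \<longleftrightarrow> p (s x) = Some (s y)"
  using assms unfolding relabel_def by (metis map_option_eq_Some)

lemma relabel_relabel:
  assumes "\<And>x. s (s x) = x"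
  shows "relabel s (relabel s p) = p"
proof
  fix x show "relabel s (relabel s p) x = p x"
    by (cases "p x") (simp_all add: relabel_def assms)
qed

lemma desc_relabel_mono:
  assumes "\<And>x. s (s x) = x" "x \<in> desc p y"
  shows "s x \<in> desc (relabel s p) (s y)"
  using assms(2)
proof (induction rule: desc_induct)
  case (step x z)
  then have "relabel s p (s x) = Some (s z)" using relabel_eq_Some[of s] assms(1) by simp
  then show ?case using step.IH desc_parent[of "relabel s p" "s x"] desc_trans by fastforce
qed simp

lemma desc_relabel:
  assumes "\<And>x. s (s x) = x"
  shows "desc (relabel s p) y = s ` desc p (s y)"
proof
  show "desc (relabel s p) y \<subseteq> s ` desc p (s y)"
  proof
    fix x assume "x \<in> desc (relabel s p) y"
    then have "s x \<in> desc p (s y)" 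
      using desc_relabel_mono[of s x "relabel s p" y] relabel_relabel[of s p] assms by simp
    then show "x \<in> s ` desc p (s y)" using assms by (metis image_eqI)
  qed
  show "s ` desc p (s y) \<subseteq> desc (relabel s p) y"
    using desc_relabel_mono[of s _ p "s y"] assms by auto
qed

lemma connected_on_image:
  assumes "\<And>x y. E (s x) (s y) \<longleftrightarrow> E x y" "connected_on E X"
  shows "connected_on E (s ` X)"
proof -
  have "(s x, s y) \<in> (ind_rel E (s ` X))\<^sup>*" if "(x, y) \<in> (ind_rel E X)\<^sup>*" for x y
    using that
  proof (induction rule: rtrancl_induct)
    case (step y z)
    then have "(s y, s z) \<in> ind_rel E (s ` X)" by (auto simp: ind_rel_def assms(1))
    then show ?case using step.IH by (rule rtrancl_into_rtrancl[rotated])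
  qed simp
  then show ?thesis using assms(2) unfolding connected_on_def by blast
qed

lemma sforest_relabel:
  assumes "finite V" "symp E" "\<And>x. s (s x) = x" "\<And>x y. E (s x) (s y) \<longleftrightarrow> E x y"
    "\<And>x. s x \<in> V \<longleftrightarrow> x \<in> V" "sforest V E p"
  shows "sforest V E (relabel s p)"
proof -
  have "elimination_forest V E p" using assms sforest_iff_elimination_forest by blast
  note f = this[unfolded elimination_forest_def]
  note eq = relabel_eq_Some[of s p, OF assms(3)] and D = desc_relabel[of s p, OF assms(3)]
  have mem: "x \<in> s ` A \<longleftrightarrow> s x \<in> A" for x A using assms(3) by (metis imageE image_eqI)
  have "acyclic (par_rel (relabel s p))"
  proof (intro acyclicI allI notI)
    fix x assume "(x, x) \<in> (par_rel (relabel s p))\<^sup>+"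
    then obtain y where "relabel s p x = Some y" "y \<in> desc (relabel s p) x"
      by (auto simp: desc_def par_rel_def dest: tranclD)
    then have "p (s x) = Some (s y)" "s y \<in> desc p (s x)" using eq D mem by auto
    then show False using acyclic_no_parent_desc[of p "s x" "s y"] f by blast
  qed
  moreover have "x \<in> V \<and> y \<in> V" if "relabel s p x = Some y" for x y
    using that eq[of x y] f assms(5) by metis
  moreover have "connected_on E (desc (relabel s p) x)" if "x \<in> V" for x
    unfolding D using f assms(5) that by (intro connected_on_image assms(4)) auto
  moreover have "x \<in> desc (relabel s p) y \<or> y \<in> desc (relabel s p) x"
    if "x \<in> V" "y \<in> V" "E x y" for x y
    unfolding D mem using that f assms(4,5) by blast
  ultimately have "elimination_forest V E (relabel s p)" unfolding elimination_forest_def by blast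
  then show ?thesis using assms sforest_iff_elimination_forest by blast
qed

lemma rotate_relabel:
  assumes "\<And>x. s (s x) = x" "\<And>x y. E (s x) (s y) \<longleftrightarrow> E x y"
  shows "rotate E (relabel s p) (s u) (s v) = relabel s (rotate E p u v)"
proof
  fix x
  have inj: "s x = s y \<longleftrightarrow> x = y" for x y using assms(1) by metis
  have sx: "x = s y \<longleftrightarrow> s x = y" for y using assms(1) by metis
  have e: "(\<exists>y\<in>desc (relabel s p) x. E (s u) y) \<longleftrightarrow> (\<exists>y\<in>desc p (s x). E u y)"
    unfolding desc_relabel[of s, OF assms(1)] using assms(2) by auto
  have pv: "relabel s p x = Some (s v) \<longleftrightarrow> p (s x) = Some v"
    using relabel_eq_Some[of s p x "s v"] assms(1) by simp
  show "rotate E (relabel s p) (s u) (s v) x = relabel s (rotate E p u v) x"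
    unfolding rotate_def e pv sx by (auto simp: relabel_def assms(1))
qed

subsection \<open>Paths with twin swaps\<close>

text \<open>The pair is an unordered set: a later swap of the same twins may have parent and child
  exchanged, yet must carry the same label.\<close>

definition twin_swap :: "'a set \<Rightarrow> ('a \<Rightarrow> 'a \<Rightarrow> bool) \<Rightarrow> 'a set \<Rightarrow> ('a \<Rightarrow> 'a option) \<Rightarrow> ('a \<Rightarrow> 'a option) \<Rightarrow> bool" where
  "twin_swap V E P p q \<longleftrightarrow> sforest V E p \<and> (\<exists>a b. P = {a, b} \<and> p b = Some a \<and> q = rotate E p a b)"

text \<open>Labels record which steps are budgeted: \<open>Some P\<close> is a rotation of the two twins in \<open>P\<close>,
  while \<open>None\<close> is an arbitrary rotation, counted against the length of the path in
  $\mathcal{R}(G-S)$.\<close>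
fun rot_step :: "'a set \<Rightarrow> ('a \<Rightarrow> 'a \<Rightarrow> bool) \<Rightarrow> 'a set \<Rightarrow> 'a set option \<Rightarrow> ('a \<Rightarrow> 'a option) \<Rightarrow> ('a \<Rightarrow> 'a option) \<Rightarrow> bool" where
  "rot_step V E W None p q \<longleftrightarrow> (p, q) \<in> rot_edge V E"
| "rot_step V E W (Some P) p q \<longleftrightarrow> P \<subseteq> W \<and> twin_swap V E P p q"

fun rot_path :: "'a set \<Rightarrow> ('a \<Rightarrow> 'a \<Rightarrow> bool) \<Rightarrow> 'a set \<Rightarrow> 'a set option list \<Rightarrow> ('a \<Rightarrow> 'a option) \<Rightarrow> ('a \<Rightarrow> 'a option) \<Rightarrow> bool" where
  "rot_path V E W [] p q \<longleftrightarrow> p = q"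
| "rot_path V E W (k # ks) p q \<longleftrightarrow> (\<exists>r. rot_step V E W k p r \<and> rot_path V E W ks r q)"

lemma rot_path_append:
  "rot_path V E W (ks @ ls) p q \<longleftrightarrow> (\<exists>r. rot_path V E W ks p r \<and> rot_path V E W ls r q)"
  by (induction ks arbitrary: p) auto

lemma not_distinct_filter_Some:
  assumes "\<not> distinct (filter (\<lambda>k. k \<noteq> None) ks)"
  shows "\<exists>as P bs cs. ks = as @ Some P # bs @ Some P # cs"
  using assms
proof (induction ks)
  case (Cons k ks)
  show ?case
  proof (cases "\<exists>P. k = Some P \<and> Some P \<in> set ks")
    case True
    then obtain P bs cs where "k = Some P" "ks = bs @ Some P # cs" by (auto dest: split_list)
    then have "k # ks = [] @ Some P # bs @ Some P # cs" by simp
    then show ?thesis by blast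
  next
    case False
    then have "\<not> distinct (filter (\<lambda>k. k \<noteq> None) ks)" using Cons.prems by (auto split: if_splits)
    then obtain as P bs cs where "ks = as @ Some P # bs @ Some P # cs" using Cons.IH by blast
    then have "k # ks = (k # as) @ Some P # bs @ Some P # cs" by simp
    then show ?thesis by blast
  qed
qed simp

lemma count_list_map_map_option_None: "count_list (map (map_option f) ks) None = count_list ks None"
  by (induction ks) auto

context
  fixes V W :: "'a set" and E :: "'a \<Rightarrow> 'a \<Rightarrow> bool"
  assumes G: "graph V E" and WV: "W \<subseteq> V"
    and twins: "\<forall>u\<in>W. \<forall>v\<in>W. cnbhd V E u = cnbhd V E v"
begin

abbreviation (input) E\<^sub>W where "E\<^sub>W \<equiv> del_edges_in E W"

section \<open>True twins: adjacency, transpositions and deleted edges\<close>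

lemma graph_facts: "finite V" "symp E" "symp E\<^sub>W" "\<And>x y. E\<^sub>W x y \<Longrightarrow> E x y" "\<And>x. \<not> E x x"
  using G unfolding graph_def symp_def del_edges_in_def by blast+

lemma twins_adjacent:
  assumes "u \<in> W" "v \<in> W" "u \<noteq> v"
  shows "E u v"
proof -
  have "cnbhd V E u = cnbhd V E v" using twins assms by blast
  then have "v \<in> cnbhd V E u" by (simp add: cnbhd_def)
  then show ?thesis using assms(3) by (simp add: cnbhd_def)
qed

lemma twins_neighbours:
  assumes "u \<in> W" "v \<in> W" "x \<noteq> u" "x \<noteq> v"
  shows "E u x \<longleftrightarrow> E v x"
proof -
  have "cnbhd V E u = cnbhd V E v" using twins assms by blast
  then have "x \<in> cnbhd V E u \<longleftrightarrow> x \<in> cnbhd V E v" by simp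
  moreover have "E u x \<Longrightarrow> x \<in> V" "E v x \<Longrightarrow> x \<in> V" using G unfolding graph_def by blast+
  ultimately show ?thesis using assms(3,4) by (auto simp: cnbhd_def)
qed

text \<open>Both twins have the same neighbours outside the pair, and an edge between them is only
  reversed.\<close>

lemma twins_automorphism:
  assumes "a \<in> W" "b \<in> W"
  shows "E (transpose a b x) (transpose a b y) \<longleftrightarrow> E x y"
proof -
  have s: "E x y \<longleftrightarrow> E y x" for x y using sympD[OF graph_facts(2)] by blast
  consider "x = y" | "x \<notin> {a, b}" "y \<notin> {a, b}" | "x \<notin> {a, b}" "y \<in> {a, b}"
    | "x \<in> {a, b}" "y \<notin> {a, b}" | "x \<in> {a, b}" "y \<in> {a, b}" "x \<noteq> y" by blast
  then show ?thesis
  proof cases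
    case 3
    then show ?thesis
      using twins_neighbours[OF assms, of x] s[of x a] s[of x b] by (auto simp: transpose_def)
  next
    case 4
    then show ?thesis using twins_neighbours[OF assms, of y] by (auto simp: transpose_def)
  next
    case 5
    then show ?thesis using s[of a b] by (auto simp: transpose_def)
  qed (use graph_facts(5) in \<open>auto simp: transpose_def\<close>)
qed

text \<open>From a vertex \<open>x\<close> of \<open>X\<close> outside \<open>W\<close>, an edge
  between twins \<open>y\<close> and \<open>z\<close> can be bypassed: if \<open>x\<close> reaches
  \<open>y\<close>, some surviving edge joins \<open>y\<close> to a vertex \<open>n\<close>, which
  is then outside \<open>W\<close> and, by the twin property, adjacent to \<open>z\<close>.\<close>

lemma connected_on_del_edges:
  assumes "connected_on E X" "\<not> X \<subseteq> W"
  shows "connected_on E\<^sub>W X"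
proof -
  obtain x where x: "x \<in> X" "x \<notin> W" using assms(2) by blast
  have "component E X x \<subseteq> component E\<^sub>W X x"
  proof (rule component_closed)
    fix y z assume *: "y \<in> component E\<^sub>W X x" "y \<in> X" "z \<in> X" "E y z"
    show "z \<in> component E\<^sub>W X x"
    proof (cases "y \<in> W \<and> z \<in> W")
      case True
      have "(y, x) \<in> (ind_rel E\<^sub>W X)\<^sup>*"
        using component_sym[OF graph_facts(3) *(1)] by (simp add: component_def)
      moreover have "y \<noteq> x" using True x by blast
      ultimately obtain n where "(y, n) \<in> ind_rel E\<^sub>W X" by (auto elim: converse_rtranclE)
      then have n: "n \<in> X" "E\<^sub>W y n" by (auto simp: ind_rel_def)
      have nW: "n \<notin> W" using n True by (auto simp: del_edges_in_def)
      have "E z n" using twins_neighbours[of y z n] True nW graph_facts(4)[OF n(2)] by auto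
      then have "E\<^sub>W n z" using nW sympD[OF graph_facts(2)] by (auto simp: del_edges_in_def)
      moreover have "n \<in> component E\<^sub>W X x" using component_edge[of y E\<^sub>W X x n] * n by blast
      ultimately show ?thesis using component_edge[of n E\<^sub>W X x z] *(3) n(1) by blast
    next
      case False
      then have "E\<^sub>W y z" using *(4) by (auto simp: del_edges_in_def)
      then show ?thesis using component_edge[of y E\<^sub>W X x z] * by blast
    qed
  qed simp
  moreover have "component E X x = X"
    using connected_on_iff_component[OF graph_facts(2) x(1)] assms(1) by simp
  ultimately show ?thesis
    using connected_on_iff_component[OF graph_facts(3) x(1)] component_subset[OF x(1), of E\<^sub>W] by blast
qed

lemma component_del_edges_within:
  assumes "X \<subseteq> W" "x \<in> X"
  shows "component E\<^sub>W X x = {x}"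
proof -
  have "component E\<^sub>W X x \<subseteq> {x}"
    by (rule component_closed) (use assms in \<open>auto simp: del_edges_in_def\<close>)
  then show ?thesis using component_refl[of x E\<^sub>W X] by blast
qed

text \<open>A subtree loses a vertex under projection only if it has shrunk to a clique of twins, all of
  whose common neighbours have already been removed.\<close>
lemma desc_within_twins:
  assumes p: "sforest V E p" "projects V E\<^sub>W p p'" and x: "u \<in> V" "v \<in> desc p u" "v \<notin> desc p' u"
  shows "desc p u \<subseteq> W"
proof (rule ccontr)
  assume n: "\<not> ?thesis"
  have "connected_on E (desc p u)"
    using tubing_connected[OF sforest_tubing(1)[OF graph_facts(1,2) p(1)] x(1)] .
  then have "connected_on E\<^sub>W (desc p u)" using connected_on_del_edges n by blast
  then have "component E\<^sub>W (desc p u) u = desc p u"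
    using connected_on_iff_component[OF graph_facts(3) desc_refl[of u p]] by simp
  then show False using p(2) x by (simp add: projects_def)
qed

text \<open>The two tubes that change are contained in \<open>W\<close> before and after. All edges
  are deleted there, so each of them projects to a singleton both times.\<close>

lemma projects_rotate_within:
  assumes p: "sforest V E p" "projects V E\<^sub>W p p'" and pv: "p b = Some a" and sub: "desc p a \<subseteq> W"
  shows "projects V E\<^sub>W (rotate E p a b) p'"
proof -
  note q = sforest_rotate[OF graph_facts(1,2) p(1) pv]
  note tub = sforest_tubing(1)[OF graph_facts(1,2) p(1)]
  have cov: "covered V (desc p) b a" using sforest_covered[OF graph_facts(1,2) p(1)] pv by simp
  note P = rot_tubing_props[OF graph_facts(2) tub cov] and c = coveredD[OF cov]
  have W: "component E\<^sub>W (desc p x) x = {x}" if "x = a \<or> x = b" for x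
  proof -
    have "desc p x \<subseteq> W" using that sub desc_trans[OF c(3)] by blast
    then show ?thesis using component_del_edges_within desc_refl by metis
  qed
  have "component E\<^sub>W (desc (rotate E p a b) x) x = component E\<^sub>W (desc p x) x" if x: "x \<in> V" for x
  proof (cases "x = a \<or> x = b")
    case True
    then have "desc (rotate E p a b) x \<subseteq> W" using q(2)[OF x] P(4,5,7) sub by auto
    then have "component E\<^sub>W (desc (rotate E p a b) x) x = {x}"
      using component_del_edges_within desc_refl by metis
    then show ?thesis using W[OF True] by simp
  qed (use q(2)[OF x] P(6) in auto)
  then show ?thesis using p(2) by (simp add: projects_def)
qed

text \<open>A rotation of the projection can be copied in the lift only if \<open>v\<close> is a
  child of \<open>u\<close> there too. If the parent is some other \<open>w\<close>, then the
  projected tube of \<open>w\<close> has lost \<open>v\<close>, so \<open>desc p w\<close> lies in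
  \<open>W\<close> and swapping \<open>v\<close> with \<open>w\<close> keeps the projection. The
  subtree of \<open>v\<close> grows with each swap, so this ends.\<close>

lemma rot_path_raise:
  assumes "sforest V E p" "projects V E\<^sub>W p p'" "p' v = Some u"
  shows "\<exists>ks q. rot_path V E W ks p q \<and> count_list ks None = 0 \<and> sforest V E q
     \<and> projects V E\<^sub>W q p' \<and> q v = Some u"
  using assms(1,2)
proof (induction "card V - card (desc p v)" arbitrary: p rule: less_induct)
  case less
  note p = less.prems
  note fs = graph_facts(1,2)
  note tub = sforest_tubing(1)[OF fs p(1)]
  have p': "sforest V E\<^sub>W p'" using p(2) by (simp add: projects_def)
  have cov': "covered V (desc p') v u" using sforest_covered[OF fs(1) graph_facts(3) p'] assms(3) by simp
  note c' = coveredD[OF cov']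
  have vu: "v \<in> desc p u" using projects_subset[OF fs graph_facts(3,4) p(2) c'(2)] c'(3) by blast
  then obtain w where w: "p v = Some w" "w \<in> desc p u" using c'(4) by (auto elim: desc_cases)
  show ?case
  proof (cases "w = u")
    case True
    have "rot_path V E W [] p p" by simp
    then show ?thesis using True w(1) p by (metis count_list.simps(1))
  next
    case False
    have cov: "covered V (desc p) v w" using sforest_covered[OF fs p(1)] w(1) by simp
    note c = coveredD[OF cov] and P = rot_tubing_props[OF fs(2) tub cov]
    \<comment> \<open>If \<open>v\<close> were still below \<open>w\<close> in the projection, then
      its parent \<open>u\<close> would be too; but \<open>w\<close> is properly below
      \<open>u\<close> in the lift.\<close>
    have "v \<notin> desc p' w"
    proof
      assume "v \<in> desc p' w"
      then have "u \<in> desc p' w" using c'(5)[OF c(2)] c(4) by blast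
      then have "u \<in> desc p w" using projects_subset[OF fs graph_facts(3,4) p(2) c(2)] by blast
      then show False using tubing_antisym[OF tub c(2)] w(2) False tubing_antisym[OF tub c'(2) w(2)] by simp
    qed
    then have sub: "desc p w \<subseteq> W" using desc_within_twins[OF p c(2,3)] by blast
    let ?q = "rotate E p w v"
    note q = sforest_rotate[OF fs p(1) w(1)]
    have proj: "projects V E\<^sub>W ?q p'" using projects_rotate_within[OF p w(1) sub] .
    have "{w, v} \<subseteq> W" using sub c(3) desc_refl[of w p] by blast
    then have st: "rot_step V E W (Some {w, v}) p ?q" using p(1) w(1) by (auto simp: twin_swap_def)
    have Dq: "desc ?q v = desc p w" using q(2)[OF c(1)] P(4) by simp
    have fin: "finite (desc p w)" using tubing_subset[OF tub c(2)] fs(1) finite_subset by blast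
    have "desc p v \<subset> desc p w" using desc_trans[OF c(3)] covered_not_mem[OF tub cov] desc_refl[of w p] by blast
    then have "card (desc p v) < card (desc ?q v)" unfolding Dq by (rule psubset_card_mono[OF fin])
    moreover have "card (desc ?q v) \<le> card V" unfolding Dq using tubing_subset[OF tub c(2)] fs(1) card_mono by blast
    ultimately have "card V - card (desc ?q v) < card V - card (desc p v)" by simp
    from less.hyps[OF this q(1) proj] obtain ks r where r: "rot_path V E W ks ?q r" "count_list ks None = 0"
      "sforest V E r" "projects V E\<^sub>W r p'" "r v = Some u" by blast
    have "rot_path V E W (Some {w, v} # ks) p r" using st r(1) by auto
    moreover have "count_list (Some {w, v} # ks) None = 0" using r(2) by simp
    ultimately show ?thesis using r(3-5) by blast
  qed
qed

text \<open>Sorting by adjacent swaps: the measure counts the inversions, the descendant pairs of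
  \<open>p\<close> that are not descendant pairs of \<open>q\<close>. The projection can miss such a
  pair only inside a subtree contained in \<open>W\<close>, so every swap made is one of
  twins.\<close>

lemma rot_path_same_projection:
  assumes "sforest V E p" "projects V E\<^sub>W p p'" "sforest V E q" "projects V E\<^sub>W q p'"
  shows "\<exists>ks. rot_path V E W ks p q \<and> count_list ks None = 0"
  using assms(1,2)
proof (induction "card {(x, y). y \<in> V \<and> x \<in> desc p y \<and> x \<notin> desc q y}" arbitrary: p rule: less_induct)
  case less
  note p = less.prems
  note fs = graph_facts(1,2)
  note tub = sforest_tubing(1)[OF fs p(1)] and tubq = sforest_tubing(1)[OF fs assms(3)]
  let ?I = "\<lambda>p. {(x, y). y \<in> V \<and> x \<in> desc p y \<and> x \<notin> desc q y}"
  show ?case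
  proof (cases "\<forall>y\<in>V. desc p y \<subseteq> desc q y")
    case True
    have "desc p y = desc q y" if "y \<in> V" for y
      using tubing_eqI[OF fs(2) tub tubq _ that] True by blast
    then have "p = q" using sforest_eqI[OF fs p(1) assms(3)] by blast
    then have "rot_path V E W [] p q" by simp
    then show ?thesis by (metis count_list.simps(1))
  next
    case False
    then obtain x y where xy: "y \<in> V" "x \<in> desc p y" "x \<notin> desc q y" by blast
    \<comment> \<open>If every single arc of \<open>p\<close> agreed with \<open>q\<close>, then so
      would the chain of arcs from \<open>x\<close> to \<open>y\<close>.\<close>
    have "\<exists>u v. p v = Some u \<and> v \<notin> desc q u"
    proof (rule ccontr)
      assume no: "\<not> ?thesis"
      from xy(2) have "x \<in> desc q y"
      proof (induction rule: desc_induct)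
        case (step x z)
        then show ?case using no desc_trans[OF step.IH] by blast
      qed simp
      then show False using xy(3) by simp
    qed
    then obtain u v where uv: "p v = Some u" "v \<notin> desc q u" by blast
    have cov: "covered V (desc p) v u" using sforest_covered[OF fs p(1)] uv(1) by simp
    note c = coveredD[OF cov] and P = rot_tubing_props[OF fs(2) tub cov]
    have "v \<notin> desc p' u"
      using projects_subset[OF fs graph_facts(3,4) assms(4) c(2)] uv(2) by blast
    then have sub: "desc p u \<subseteq> W" using desc_within_twins[OF p c(2,3)] by blast
    then have W: "u \<in> W" "v \<in> W" using c(3) desc_refl[of u p] by auto
    \<comment> \<open>Twins are adjacent, hence comparable in \<open>q\<close>, which must order
      this pair the other way; so \<open>u\<close> below \<open>v\<close> is not a new inversion
      after the swap.\<close>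
    have uq: "u \<in> desc q v"
      using tubing_edge[OF tubq c(2,1)] twins_adjacent[OF W] c(4) uv(2) by blast
    let ?r = "rotate E p u v"
    note r = sforest_rotate[OF fs p(1) uv(1)]
    have proj: "projects V E\<^sub>W ?r p'" using projects_rotate_within[OF p uv(1) sub] .
    have st: "rot_step V E W (Some {u, v}) p ?r" using p(1) uv(1) W by (auto simp: twin_swap_def)
    \<comment> \<open>The subtree of \<open>u\<close> is a clique of twins, hence a chain in which
      \<open>v\<close> comes directly below \<open>u\<close>.\<close>
    have below: "x \<in> desc p v" if "x \<in> desc p u" "x \<noteq> u" for x
    proof (cases "x = v")
      case ne: False
      have x: "x \<in> V" "x \<in> W" using that sub WV by auto
      have "v \<in> desc p x \<or> x \<in> desc p v"
        using tubing_edge[OF tub c(1) x(1)] twins_adjacent[OF W(2) x(2)] ne by blast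
      moreover have "v \<notin> desc p x"
        using c(5)[OF x(1)] ne tubing_antisym[OF tub c(2) that(1)] that(2) by blast
      ultimately show ?thesis by blast
    qed simp
    have "?I ?r \<subseteq> ?I p"
    proof clarify
      fix x y assume y: "y \<in> V" "x \<in> desc ?r y" "x \<notin> desc q y"
      have D: "x \<in> rot_tubing E (desc p) u v y" using y(2) r(2)[OF y(1)] by simp
      consider "y = v" | "y = u" | "y \<noteq> u" "y \<noteq> v" by blast
      then show "x \<in> desc p y"
      proof cases
        case 1
        then have "x \<in> desc p u" "x \<noteq> u" using D P(4) y(3) uq by auto
        then show ?thesis using below 1 by blast
      next
        case 2
        then show ?thesis using D P(5,7) by auto
      next
        case 3
        then show ?thesis using D P(6) by simp
      qed
    qed
    moreover have "(v, u) \<in> ?I p" using c uv(2) by simp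
    moreover have "(v, u) \<notin> ?I ?r" using r(2)[OF c(2)] P(5,7) by auto
    ultimately have ss: "?I ?r \<subset> ?I p" by blast
    have "?I p \<subseteq> V \<times> V" using tubing_subset[OF tub] by blast
    then have "finite (?I p)" using fs(1) finite_subset by blast
    then have "card (?I ?r) < card (?I p)" using ss by (rule psubset_card_mono)
    from less.hyps[OF this r(1) proj] obtain ks where "rot_path V E W ks ?r q" "count_list ks None = 0" by blast
    then have "rot_path V E W (Some {u, v} # ks) p q" "count_list (Some {u, v} # ks) None = 0"
      using st by auto
    then show ?thesis by blast
  qed
qed

text \<open>Before each rotation the required arc is produced in the lift by swaps labelled
  \<open>Some\<close>, so only the rotation itself contributes a \<open>None\<close>. The end of the
  lifted path is controlled only through its projection.\<close>

lemma rot_path_lift: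
  assumes "(p', q') \<in> (rot_edge V E\<^sub>W) ^^ n" "sforest V E p" "projects V E\<^sub>W p p'"
  shows "\<exists>ks q. rot_path V E W ks p q \<and> count_list ks None \<le> n \<and> sforest V E q \<and> projects V E\<^sub>W q q'"
  using assms
proof (induction n arbitrary: q')
  case 0
  then have "rot_path V E W [] p p \<and> count_list ([] :: 'a set option list) None \<le> 0 \<and> sforest V E p \<and> projects V E\<^sub>W p q'" by simp
  then show ?case by blast
next
  case (Suc n)
  then obtain r' where r': "(p', r') \<in> (rot_edge V E\<^sub>W) ^^ n" "(r', q') \<in> rot_edge V E\<^sub>W" by auto
  obtain ks r where r: "rot_path V E W ks p r" "count_list ks None \<le> n" "sforest V E r" "projects V E\<^sub>W r r'"
    using Suc.IH[OF r'(1) Suc.prems(2,3)] by blast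
  obtain u v where uv: "r' v = Some u" "q' = rotate E\<^sub>W r' u v"
    using r'(2) rot_edge_iff[OF graph_facts(1,3)] by (auto simp: is_rotation_def)
  obtain ls s where s: "rot_path V E W ls r s" "count_list ls None = 0" "sforest V E s"
     "projects V E\<^sub>W s r'" "s v = Some u" using rot_path_raise[OF r(3,4) uv(1)] by blast
  let ?q = "rotate E s u v"
  have "rot_step V E W None s ?q"
    using s(3,5) rot_edge_iff[OF graph_facts(1,2)] by (auto simp: is_rotation_def)
  then have "rot_path V E W (ks @ ls @ [None]) p ?q" using r(1) s(1) by (auto simp: rot_path_append)
  moreover have "count_list (ks @ ls @ [None]) None \<le> Suc n" using r(2) s(2) by simp
  moreover have "projects V E\<^sub>W ?q q'"
    using projects_rotate_both[OF graph_facts(1-4) s(3,4,5) uv(1)] uv(2) by simp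
  ultimately show ?case using sforest_rotate(1)[OF graph_facts(1,2) s(3,5)] by blast
qed

text \<open>Every subtree of \<open>b\<close> moves to \<open>a\<close>, since a neighbour of
  \<open>b\<close> in it is also a neighbour of \<open>a\<close>. Moreover \<open>a\<close> has no
  child besides \<open>b\<close>: its subtree would contain a neighbour of \<open>a\<close>, hence
  of \<open>b\<close>, which would have to be comparable with \<open>b\<close>. So only two labels
  are exchanged.\<close>

lemma rotate_twins:
  assumes p: "sforest V E p" and pb: "p b = Some a" and W: "a \<in> W" "b \<in> W"
  shows "rotate E p a b = relabel (transpose a b) p"
proof
  fix x
  note fs = graph_facts(1,2)
  note tub = sforest_tubing(1)[OF fs p] and par = sforest_covered[OF fs p]
  have cov: "covered V (desc p) b a" using pb par by simp
  note c = coveredD[OF cov]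
  have ba: "a \<notin> desc p b" using covered_not_mem[OF tub cov] .
  consider "x = b" | "x = a" | "x \<noteq> a" "x \<noteq> b" "p x = Some b" | "x \<noteq> a" "x \<noteq> b" "p x = Some a"
    | "x \<noteq> a" "x \<noteq> b" "p x \<noteq> Some a" "p x \<noteq> Some b" by blast
  then show "rotate E p a b x = relabel (transpose a b) p x"
  proof cases
    case 1
    have "p a \<noteq> Some a" using par[of a a] by (simp add: covered_def)
    moreover have "p a \<noteq> Some b" using ba desc_parent[of p a b] by blast
    ultimately show ?thesis using 1
      by (cases "p a") (auto simp: rotate_def relabel_def transpose_def)
  next
    case 2
    then show ?thesis using c(4) pb by (auto simp: rotate_def relabel_def)
  next
    case 3
    then have cx: "covered V (desc p) x b" using par by simp
    obtain y where y: "y \<in> desc p x" "E b y" using covered_edge[OF fs(2) tub cx] by blast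
    have "desc p x \<subseteq> desc p b" using desc_trans[of x p b] desc_parent[of p x b] 3(3) by blast
    then have "y \<noteq> a" "y \<noteq> b" using y(1) ba covered_not_mem[OF tub cx] by blast+
    then have "E a y" using twins_neighbours[OF W] y(2) by blast
    then have "\<exists>y\<in>desc p x. E a y" using y(1) by blast
    then show ?thesis using 3 by (simp add: rotate_def relabel_def)
  next
    case 4
    then have cx: "covered V (desc p) x a" using par by simp
    note d = coveredD[OF cx]
    have nax: "a \<notin> desc p x" using covered_not_mem[OF tub cx] .
    have nbx: "b \<notin> desc p x" using c(5)[OF d(1)] 4(2) nax by blast
    have nxb: "x \<notin> desc p b" using d(5)[OF c(1)] 4(2) ba by blast
    obtain y where y: "y \<in> desc p x" "E a y" using covered_edge[OF fs(2) tub cx] by blast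
    have yV: "y \<in> V" using y(1) tubing_subset[OF tub d(1)] by blast
    have "y \<noteq> a" "y \<noteq> b" using y(1) nax nbx by blast+
    then have "E b y" using twins_neighbours[OF W] y(2) by blast
    then have "b \<in> desc p y \<or> y \<in> desc p b" using tubing_edge[OF tub c(1) yV] by blast
    then have False
    proof
      assume "b \<in> desc p y"
      then show False using desc_trans[OF y(1)] nbx by blast
    next
      assume "y \<in> desc p b"
      then show False using desc_chain[OF y(1)] nbx nxb by blast
    qed
    then show ?thesis ..
  next
    case 5
    then show ?thesis by (cases "p x") (auto simp: rotate_def relabel_def transpose_def)
  qed
qed

section \<open>Cancelling repeated swaps\<close>

lemma transpose_twins_facts:
  assumes "a \<in> W" "b \<in> W"
  shows "\<And>x. transpose a b (transpose a b x) = x" "\<And>x. transpose a b x \<in> V \<longleftrightarrow> x \<in> V"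
    "\<And>P. P \<subseteq> W \<Longrightarrow> transpose a b ` P \<subseteq> W"
  using assms WV by (auto simp: transpose_def)

text \<open>The labels are transported as well: a swap becomes the swap of the image pair, still
  inside \<open>W\<close>, and a \<open>None\<close> step remains a \<open>None\<close>
  step.\<close>

lemma rot_step_relabel:
  assumes W: "a \<in> W" "b \<in> W" and st: "rot_step V E W k p q"
  shows "rot_step V E W (map_option (image (transpose a b)) k)
    (relabel (transpose a b) p) (relabel (transpose a b) q)"
proof -
  let ?s = "transpose a b"
  note t = transpose_twins_facts[OF W] and aut = twins_automorphism[OF W]
  note fs = graph_facts(1,2)
  have sf: "sforest V E (relabel ?s p)" if "sforest V E p" for p
    using sforest_relabel[of V E ?s, OF fs t(1) aut t(2) that] .
  have rot: "(relabel ?s p) (?s v) = Some (?s u) \<and> relabel ?s (rotate E p u v) = rotate E (relabel ?s p) (?s u) (?s v)"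
    if "p v = Some u" for p u v
    using that rotate_relabel[of ?s E p u v, OF t(1) aut] relabel_eq_Some[of ?s p "?s v" "?s u", OF t(1)] t(1)
    by simp
  show ?thesis
  proof (cases k)
    case None
    then obtain u v where "sforest V E p" "p v = Some u" "q = rotate E p u v"
      using st rot_edge_iff[OF fs] by (auto simp: is_rotation_def)
    then have "is_rotation E (relabel ?s p) (relabel ?s q)" "sforest V E (relabel ?s p)"
      using rot sf unfolding is_rotation_def by blast+
    then show ?thesis using None rot_edge_iff[OF fs] by simp
  next
    case (Some P)
    then obtain u v where uv: "P \<subseteq> W" "sforest V E p" "P = {u, v}" "p v = Some u" "q = rotate E p u v"
      using st by (auto simp: twin_swap_def)
    have "?s ` P = {?s u, ?s v}" using uv(3) by simp
    then have "twin_swap V E (?s ` P) (relabel ?s p) (relabel ?s q)"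
      using rot[of p v u] uv(4) sf[OF uv(2)] uv(5) unfolding twin_swap_def by blast
    then show ?thesis using Some t(3)[OF uv(1)] by simp
  qed
qed

lemma rot_path_relabel:
  assumes "a \<in> W" "b \<in> W" and "rot_path V E W ks p q"
  shows "rot_path V E W (map (map_option (image (transpose a b))) ks)
    (relabel (transpose a b) p) (relabel (transpose a b) q)"
  using assms(3)
proof (induction ks arbitrary: p)
  case (Cons k ks)
  then show ?case using rot_step_relabel[OF assms(1,2)] by fastforce
qed simp

text \<open>A second swap of the same two twins cancels the first one, provided that the steps in
  between are relabelled by the transposition of the twins.\<close>
lemma rot_path_cancel:
  assumes "rot_path V E W (as @ Some P # bs @ Some P # cs) p q"
  shows "\<exists>f. rot_path V E W (as @ map (map_option f) bs @ cs) p q"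
proof -
  obtain p1 p2 p3 p4 where *: "rot_path V E W as p p1" "rot_step V E W (Some P) p1 p2"
    "rot_path V E W bs p2 p3" "rot_step V E W (Some P) p3 p4" "rot_path V E W cs p4 q"
    using assms by (auto simp: rot_path_append)
  obtain a b where ab: "P = {a, b}" "sforest V E p1" "p1 b = Some a" "p2 = rotate E p1 a b"
    using *(2) by (auto simp: twin_swap_def)
  have W: "a \<in> W" "b \<in> W" using *(2) ab(1) by auto
  let ?s = "transpose a b"
  obtain c d where cd: "P = {c, d}" "sforest V E p3" "p3 d = Some c" "p4 = rotate E p3 c d"
    using *(4) by (auto simp: twin_swap_def)
  have cdW: "c \<in> W" "d \<in> W" using cd(1) *(2) by auto
  \<comment> \<open>Parent and child may have changed roles between the two swaps, but the
    transposition is the same.\<close>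
  have "transpose c d = ?s" using ab(1) cd(1) by (auto simp: doubleton_eq_iff transpose_commute)
  then have p4: "p4 = relabel ?s p3" using rotate_twins[OF cd(2,3) cdW] cd(4) by simp
  have "relabel ?s p2 = p1"
    using rotate_twins[OF ab(2,3) W] ab(4) relabel_relabel[of ?s p1] transpose_twins_facts(1)[OF W] by simp
  \<comment> \<open>Relabelling \<open>p2\<close> undoes the first swap, and relabelling
    \<open>p3\<close> performs the second, so the relabelled segment fits between \<open>p1\<close>
    and \<open>p4\<close>.\<close>
  then have "rot_path V E W (map (map_option (image ?s)) bs) p1 p4"
    using rot_path_relabel[OF W *(3)] p4 by simp
  then have "rot_path V E W (as @ map (map_option (image ?s)) bs @ cs) p q"
    using *(1,5) by (auto simp: rot_path_append)
  then show ?thesis by blast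
qed

text \<open>Relabelling the segment in between may create new coincidences of labels, so the
  induction is on the length of the whole list, which every cancellation shortens by two.\<close>

lemma rot_path_distinct:
  assumes "rot_path V E W ks p q"
  shows "\<exists>ls. rot_path V E W ls p q \<and> count_list ls None = count_list ks None
    \<and> distinct (filter (\<lambda>k. k \<noteq> None) ls)"
  using assms
proof (induction "length ks" arbitrary: ks rule: less_induct)
  case less
  show ?case
  proof (cases "distinct (filter (\<lambda>k. k \<noteq> None) ks)")
    case False
    then obtain as P bs cs where ks: "ks = as @ Some P # bs @ Some P # cs"
      using not_distinct_filter_Some by blast
    then obtain f where f: "rot_path V E W (as @ map (map_option f) bs @ cs) p q"
      using rot_path_cancel less.prems by blast
    have "length (as @ map (map_option f) bs @ cs) < length ks"
      "count_list (as @ map (map_option f) bs @ cs) None = count_list ks None"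
      using ks by (simp_all add: count_list_map_map_option_None)
    then show ?thesis using less.hyps f by metis
  qed (use less.prems in blast)
qed

lemma rot_path_Some:
  assumes "rot_path V E W ks p q" "Some P \<in> set ks"
  shows "P \<subseteq> W \<and> card P = 2"
  using assms
proof (induction ks arbitrary: p)
  case (Cons k ks)
  show ?case
  proof (cases "k = Some P")
    case True
    then obtain a b where ab: "P \<subseteq> W" "P = {a, b}" "sforest V E p" "p b = Some a"
      using Cons.prems(1) by (auto simp: twin_swap_def)
    have "a \<noteq> b" using sforest_covered[OF graph_facts(1,2) ab(3), of b a] ab(4) by (auto simp: covered_def)
    then show ?thesis using ab by simp
  qed (use Cons in auto)
qed simp

lemma rot_path_relpow: "rot_path V E W ks p q \<Longrightarrow> (p, q) \<in> (rot_edge V E) ^^ length ks"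
proof (induction ks arbitrary: p)
  case (Cons k ks)
  then obtain r where r: "rot_step V E W k p r" "(r, q) \<in> (rot_edge V E) ^^ length ks" by auto
  have "(p, r) \<in> rot_edge V E"
    using r(1) rot_edge_iff[OF graph_facts(1,2)] by (cases k) (auto simp: twin_swap_def is_rotation_def)
  then show ?case using relpow_Suc_I2[OF _ r(2)] by (simp only: length_Cons)
qed simp

text \<open>The remaining \<open>Some\<close> labels are distinct two-element subsets of
  \<open>W\<close>; this is where the binomial coefficient comes from.\<close>

lemma rot_path_short:
  assumes "rot_path V E W ks p q"
  shows "\<exists>n \<le> count_list ks None + (card W choose 2). (p, q) \<in> (rot_edge V E) ^^ n"
proof -
  obtain ls where ls: "rot_path V E W ls p q" "count_list ls None = count_list ks None"
    "distinct (filter (\<lambda>k. k \<noteq> None) ls)" using rot_path_distinct[OF assms] by blast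
  let ?f = "filter (\<lambda>k. k \<noteq> None) ls" and ?S = "{P. P \<subseteq> W \<and> card P = 2}"
  have finW: "finite W" using WV graph_facts(1) finite_subset by blast
  have finS: "finite ?S" using finW by simp
  have "set ?f \<subseteq> Some ` ?S"
  proof
    fix k assume "k \<in> set ?f"
    then have "k \<in> set ls" "k \<noteq> None" unfolding set_filter by blast+
    then obtain P where "k = Some P" "Some P \<in> set ls" by blast
    then show "k \<in> Some ` ?S" using rot_path_Some[OF ls(1)] by blast
  qed
  then have "card (set ?f) \<le> card (Some ` ?S)" using finS by (intro card_mono) auto
  also have "\<dots> = card W choose 2" using n_subsets[OF finW] by (simp add: card_image)
  finally have "length ?f \<le> card W choose 2" using distinct_card[OF ls(3)] by simp
  moreover have "length ls = count_list ls None + length ?f" by (induction ls) auto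
  ultimately show ?thesis using rot_path_relpow[OF ls(1)] ls(2) by (intro exI[of _ "length ls"]) simp
qed

text \<open>A shortest path between the projections is lifted from \<open>p\<close>, and its end,
  which projects to \<open>q'\<close> but may differ from \<open>q\<close>, is joined to
  \<open>q\<close> by twin swaps. Cancellation is applied to the concatenated path, so both kinds of
  swaps share a single budget.\<close>

lemma rot_dist_le:
  assumes p: "sforest V E p" "projects V E\<^sub>W p p'" and q: "sforest V E q" "projects V E\<^sub>W q q'"
  shows "rot_dist V E p q \<le> rot_dist V E\<^sub>W p' q' + (card W choose 2)"
proof (cases "\<exists>n. (p', q') \<in> (rot_edge V E\<^sub>W) ^^ n")
  case True
  then have "(p', q') \<in> (rot_edge V E\<^sub>W) ^^ rot_dist V E\<^sub>W p' q'"
    unfolding rot_dist_def by (rule LeastI_ex)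
  from rot_path_lift[OF this p] obtain ks r where r: "rot_path V E W ks p r"
    "count_list ks None \<le> rot_dist V E\<^sub>W p' q'" "sforest V E r" "projects V E\<^sub>W r q'" by blast
  obtain ls where ls: "rot_path V E W ls r q" "count_list ls None = 0"
    using rot_path_same_projection[OF r(3,4) q] by blast
  have "rot_path V E W (ks @ ls) p q" using r(1) ls(1) by (auto simp: rot_path_append)
  from rot_path_short[OF this] obtain n where
    n: "n \<le> count_list (ks @ ls) None + (card W choose 2)" "(p, q) \<in> (rot_edge V E) ^^ n" by blast
  have "rot_dist V E p q \<le> n" unfolding rot_dist_def using n(2) by (rule Least_le)
  then show ?thesis using n(1) r(2) ls(2) by simp
next
  case False
  \<comment> \<open>Both distances are then the same unspecified value of LEAST on the empty predicate.\<close>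
  have "(p, q) \<notin> (rot_edge V E) ^^ n" for n
  proof
    assume "(p, q) \<in> (rot_edge V E) ^^ n"
    then have "(p, q) \<in> (rot_edge V E)\<^sup>*" by (rule relpow_imp_rtrancl)
    then obtain r where "projects V E\<^sub>W q r" "(p', r) \<in> (rot_edge V E\<^sub>W)\<^sup>*"
      using projects_rot_path[OF graph_facts(1-4) _ p(2)] by blast
    then have "(p', q') \<in> (rot_edge V E\<^sub>W)\<^sup>*" using projects_unique[OF graph_facts(1-4) q(2)] by metis
    then show False using False rtrancl_imp_relpow by metis
  qed
  then have "rot_dist V E p q = rot_dist V E\<^sub>W p' q'" using False by (simp add: rot_dist_def)
  then show ?thesis by simp
qed

end

section \<open>Finiteness and existence of search forests, and the diameter bound\<close>

lemma finite_sforests: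
  assumes "finite V" "symp E"
  shows "finite {p. sforest V E p}"
proof (rule finite_subset)
  show "{p. sforest V E p} \<subseteq> {p. \<forall>x. (x \<in> V \<longrightarrow> p x \<in> insert None (Some ` V)) \<and> (x \<notin> V \<longrightarrow> p x = None)}"
  proof clarify
    fix p x assume "sforest V E p"
    then have f: "elimination_forest V E p" using sforest_iff_elimination_forest[OF assms] by simp
    show "(x \<in> V \<longrightarrow> p x \<in> insert None (Some ` V)) \<and> (x \<notin> V \<longrightarrow> p x = None)"
      using f unfolding elimination_forest_def by (cases "p x") auto
  qed
  show "finite {p. \<forall>x. (x \<in> V \<longrightarrow> p x \<in> insert None (Some ` V)) \<and> (x \<notin> V \<longrightarrow> p x = None)}"
    by (rule finite_set_of_finite_funs) (use assms(1) in auto)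
qed

lemma finite_rot_dists:
  assumes "finite V" "symp E"
  shows "finite {rot_dist V E p q | p q. sforest V E p \<and> sforest V E q}"
proof -
  have "{rot_dist V E p q | p q. sforest V E p \<and> sforest V E q}
    = (\<lambda>(p, q). rot_dist V E p q) ` ({p. sforest V E p} \<times> {q. sforest V E q})" by auto
  then show ?thesis using finite_sforests[OF assms] by simp
qed

lemma sforest_ex:
  assumes "finite V" "symp E"
  shows "\<exists>p. sforest V E p"
proof -
  obtain f :: "'a \<Rightarrow> nat" where "inj_on f V" using finite_imp_inj_to_nat_seg[OF assms(1)] by blast
  then show ?thesis using tubing_sforest_ex[OF assms tubing_heap[OF assms(2)]] by blast
qed

theorem theorem4p7:
  fixes V W :: "'a set" and E :: "'a \<Rightarrow> 'a \<Rightarrow> bool"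
  assumes "graph V E" and "connected_on E V"
    and "W \<subseteq> V" and "card W \<ge> 2"
    and "\<forall>u\<in>W. \<forall>v\<in>W. cnbhd V E u = cnbhd V E v"
  shows "int (rot_diam V E) - int (card W choose 2) \<le> int (rot_diam V (del_edges_in E W))"
proof -
  let ?F = "del_edges_in E W"
  let ?S = "\<lambda>E. {rot_dist V E p q | p q. sforest V E p \<and> sforest V E q}"
  note g = graph_facts[OF assms(1,3,5)]
  have "?S E \<noteq> {}" using sforest_ex[OF g(1,2)] by blast
  then have "rot_diam V E \<in> ?S E" unfolding rot_diam_def by (intro Max_in finite_rot_dists g)
  then obtain p q where pq: "sforest V E p" "sforest V E q" "rot_diam V E = rot_dist V E p q" by blast
  obtain p' q' where pr: "projects V ?F p p'" "projects V ?F q q'"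
    using projects_ex[OF g(1-4)] pq by meson
  have "rot_dist V ?F p' q' \<in> ?S ?F" using pr unfolding projects_def by blast
  then have "rot_dist V ?F p' q' \<le> rot_diam V ?F"
    unfolding rot_diam_def by (intro Max_ge finite_rot_dists g(1,3))
  then show ?thesis
    using rot_dist_le[OF assms(1,3,5) pq(1) pr(1) pq(2) pr(2)] pq(3) by simp
qed

end
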